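(* Let $\mathbf{A}$ be a finite, finitely related algebra and let $B$ be a subuniverse of $\mathbf{A}$. Then $B$ is an absorbing subuniverse of $\mathbf{A}$ if and only if $B$ is a Jónsson absorbing subuniverse of $\mathbf{A}$.
   Context: A finite algebra $\mathbf{A}$ with universe $A$ is finitely related if its clone of term operations is equal to the clone of all polymorphisms of some relational structure on $A$ with finite signature (that is, with finitely many relations, each of finite arity). A subuniverse $B$ of an algebra $\mathbf{A}$ is absorbing, written $B\trianglelefteq\mathbf{A}$, if $\mathbf{A}$ has an idempotent term operation $t$ (i.e. $t(x,\dots,x)\approx x$) of some arity such that $t(B,\dots,B,A,B,\dots,B)\subseteq B$ for every position of $A$; that is, $t(a_1,\dots,a_n)\in B$ whenever all but at most one of the $a_i\in A$ belong to $B$. A subuniverse $B$ of $\mathbf{A}$ is Jónsson absorbing, written $B\trianglelefteq_J\mathbf{A}$, if $\mathbf{A}$ has a sequence of ternary terms $d_0,d_1,\dots,d_n$ (a Jónsson absorption chain) such that (i) $d_i(B,A,B)\subseteq B$ for all $i\le n$ (i.e. $d_i(b,a,b')\in B$ for all $b,b'\in B$, $a\in A$); (ii) $d_i(x,y,y)\approx d_{i+1}(x,x,y)$ holds in $\mathbf{A}$ for all $i<n$; (iii) $d_0(x,y,z)\approx x$ and $d_n(x,y,z)\approx z$ hold in $\mathbf{A}$. *)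

theory Defs
  imports "HOL-Library.FuncSet"
begin

abbreviation tuples :: "'a set \<Rightarrow> nat \<Rightarrow> 'a list set" where
  "tuples A n \<equiv> {xs. set xs \<subseteq> A \<and> length xs = n}"

text \<open>The basic operations are indexed by a set of symbols that may be empty or infinite; symbols
  of arity 0 are allowed.\<close>

record ('a, 'f) alg =
  universe :: "'a set"
  symbols :: "'f set"
  arity :: "'f \<Rightarrow> nat"
  interp :: "'f \<Rightarrow> 'a list \<Rightarrow> 'a"

definition is_algebra :: "('a, 'f) alg \<Rightarrow> bool" where
  "is_algebra \<A> \<longleftrightarrow>
    (\<forall>f \<in> symbols \<A>. \<forall>xs \<in> tuples (universe \<A>) (arity \<A> f). interp \<A> f xs \<in> universe \<A>)"

definition subuniverse :: "'a set \<Rightarrow> ('a, 'f) alg \<Rightarrow> bool" where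
  "subuniverse B \<A> \<longleftrightarrow> B \<subseteq> universe \<A> \<and>
    (\<forall>f \<in> symbols \<A>. \<forall>xs \<in> tuples B (arity \<A> f). interp \<A> f xs \<in> B)"


datatype 'f trm = Var nat | App 'f "'f trm list"

inductive is_term :: "('a, 'f) alg \<Rightarrow> nat \<Rightarrow> 'f trm \<Rightarrow> bool" for \<A> n where
  Var: "i < n \<Longrightarrow> is_term \<A> n (Var i)"
| App: "f \<in> symbols \<A> \<Longrightarrow> length ts = arity \<A> f \<Longrightarrow> (\<forall>t \<in> set ts. is_term \<A> n t)
    \<Longrightarrow> is_term \<A> n (App f ts)"

primrec eval_trm :: "('a, 'f) alg \<Rightarrow> 'a list \<Rightarrow> 'f trm \<Rightarrow> 'a" where
  "eval_trm \<A> xs (Var i) = xs ! i"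
| "eval_trm \<A> xs (App f ts) = interp \<A> f (map (eval_trm \<A> xs) ts)"

text \<open>Operations are extensional functions on tuples, so that equality of operations is equality of
  HOL functions.\<close>

definition term_op :: "('a, 'f) alg \<Rightarrow> nat \<Rightarrow> 'f trm \<Rightarrow> 'a list \<Rightarrow> 'a" where
  "term_op \<A> n t = (\<lambda>xs \<in> tuples (universe \<A>) n. eval_trm \<A> xs t)"

definition term_ops :: "('a, 'f) alg \<Rightarrow> nat \<Rightarrow> ('a list \<Rightarrow> 'a) set" where
  "term_ops \<A> n = {term_op \<A> n t |t. is_term \<A> n t}"


text \<open>A relation of arity \<open>k\<close> on \<open>A\<close> is given by a pair \<open>(k, R)\<close> with \<open>R \<subseteq> tuples A k\<close>, and a
  relational structure by its set of relations.  In the polymorphism condition \<open>rs\<close> lists \<open>n\<close>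
  members of \<open>R\<close>, to which \<open>f\<close> is applied coordinatewise.\<close>

definition polymorphisms :: "'a set \<Rightarrow> (nat \<times> 'a list set) set \<Rightarrow> nat \<Rightarrow> ('a list \<Rightarrow> 'a) set" where
  "polymorphisms A \<Gamma> n = {f \<in> tuples A n \<rightarrow>\<^sub>E A.
    \<forall>(k, R) \<in> \<Gamma>. \<forall>rs \<in> tuples R n. map (\<lambda>i. f (map (\<lambda>r. r ! i) rs)) [0..<k] \<in> R}"

text \<open>Clones consist of operations of positive arity, as usual; a nullary basic operation thus
  contributes the corresponding constant operations of each arity \<open>n \<ge> 1\<close>.\<close>

definition finitely_related :: "('a, 'f) alg \<Rightarrow> bool" where
  "finitely_related \<A> \<longleftrightarrow> (\<exists>\<Gamma>. finite \<Gamma> \<and> (\<forall>(k, R) \<in> \<Gamma>. R \<subseteq> tuples (universe \<A>) k) \<and>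
    (\<forall>n \<ge> 1. term_ops \<A> n = polymorphisms (universe \<A>) \<Gamma> n))"


definition absorbing :: "'a set \<Rightarrow> ('a, 'f) alg \<Rightarrow> bool" where
  "absorbing B \<A> \<longleftrightarrow> subuniverse B \<A> \<and>
    (\<exists>n \<ge> 1. \<exists>t \<in> term_ops \<A> n.
      (\<forall>x \<in> universe \<A>. t (replicate n x) = x) \<and>
      (\<forall>i < n. \<forall>xs \<in> tuples (universe \<A>) n. (\<forall>j < n. j \<noteq> i \<longrightarrow> xs ! j \<in> B) \<longrightarrow> t xs \<in> B))"

definition jonsson_chain :: "'a set \<Rightarrow> ('a, 'f) alg \<Rightarrow> nat \<Rightarrow> (nat \<Rightarrow> 'f trm) \<Rightarrow> bool" where
  "jonsson_chain B \<A> n d \<longleftrightarrow>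
    (\<forall>i \<le> n. is_term \<A> 3 (d i)) \<and>
    (\<forall>i \<le> n. \<forall>b \<in> B. \<forall>a \<in> universe \<A>. \<forall>b' \<in> B. term_op \<A> 3 (d i) [b, a, b'] \<in> B) \<and>
    (\<forall>i < n. \<forall>x \<in> universe \<A>. \<forall>y \<in> universe \<A>.
      term_op \<A> 3 (d i) [x, y, y] = term_op \<A> 3 (d (Suc i)) [x, x, y]) \<and>
    (\<forall>x \<in> universe \<A>. \<forall>y \<in> universe \<A>. \<forall>z \<in> universe \<A>.
      term_op \<A> 3 (d 0) [x, y, z] = x \<and> term_op \<A> 3 (d n) [x, y, z] = z)"

definition jonsson_absorbing :: "'a set \<Rightarrow> ('a, 'f) alg \<Rightarrow> bool" where
  "jonsson_absorbing B \<A> \<longleftrightarrow> subuniverse B \<A> \<and> (\<exists>n d. jonsson_chain B \<A> n d)"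

end

theory Submission
  imports Defs "HOL-Library.Ramsey"
begin

text \<open>An absorbing operation yields the chain \<open>t(x, \<dots>, x, y, z, \<dots>, z)\<close>.  Conversely, an
  \<open>n\<close>-ary absorbing operation is a solution of a constraint problem: the variables are the
  \<open>n\<close>-tuples, the constraints say that the values on each set of columns picked from a relation of
  \<open>\<Gamma>\<close> come from some idempotent polymorphism, and the value at a tuple with at most one entry
  outside \<open>B\<close> must lie in \<open>B\<close>.  The \<open>i\<close>-th projection violates the last condition only at tuples whose
  \<open>i\<close>-th entry is outside \<open>B\<close>.

  If arc consistency refutes the problem, a refuting tree with the least number of \<open>B\<close>-leaves must
  use each coordinate \<open>i\<close>; so for large \<open>n\<close> it has many leaves, and since the arities in \<open>\<Gamma>\<close> are bounded
  it contains a long path off which essential leaves branch.  By Ramsey's theorem a part of this path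
  looks the same everywhere, and the Jonsson operations connect its two ends, a contradiction.

  So there are nonempty arc consistent domains \<open>D v\<close> that are Jonsson absorbing in the domains of the
  global solutions (the idempotent polymorphisms).  They are shrunk to singletons.  Unary operations
  \<open>x \<mapsto> d\<^sub>k(x, s, x)\<close>, with \<open>s\<close> a global solution, either give a retraction onto smaller domains or,
  by a loop lemma, all act as the identity.  In the latter case singletons are Jonsson absorbing;
  starting from one of them, transport proper subsets of domains along the constraints until a
  strongly connected component is reached that cannot be left.  A walk in this component
  is followed by global solutions, and absorption then shows that the subsets in the component are
  consistent with each other, giving smaller arc consistent domains.\<close>

subsection \<open>Jonsson operations and absorbed relations\<close>

text \<open>The operations are total and only the identities are restricted to \<open>D\<close>, so
  \<open>D\<close> can be shrunk freely; closure of \<open>D\<close> under them is stated separately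
  where it is needed.\<close>

definition jonsson_ops :: "nat \<Rightarrow> 'a set \<Rightarrow> (nat \<Rightarrow> 'a \<Rightarrow> 'a \<Rightarrow> 'a \<Rightarrow> 'a) \<Rightarrow> bool" where
  "jonsson_ops n D d \<longleftrightarrow>
    (\<forall>x\<in>D. \<forall>y\<in>D. \<forall>z\<in>D. d 0 x y z = x \<and> d n x y z = z) \<and>
    (\<forall>i<n. \<forall>x\<in>D. \<forall>y\<in>D. d i x y y = d (Suc i) x x y)"

lemma jonsson_ops_subset: "jonsson_ops n D d \<Longrightarrow> D' \<subseteq> D \<Longrightarrow> jonsson_ops n D' d"
  unfolding jonsson_ops_def by blast

lemma jonsson_ops_idem:
  assumes "jonsson_ops n D d" "x \<in> D" "k \<le> n"
  shows "d k x x x = x"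
  using assms(3)
proof (induction k)
  case 0
  then show ?case using assms unfolding jonsson_ops_def by simp
next
  case (Suc k)
  then show ?case using assms unfolding jonsson_ops_def by (metis Suc_le_eq less_imp_le_nat)
qed

text \<open>The middle argument may come from another, typically larger relation \<open>R'\<close>.
  Two families of operations occur because the two ends of an edge can belong to variables with
  different operations.\<close>

definition rel_absorbs ::
  "nat \<Rightarrow> (nat \<Rightarrow> 'a \<Rightarrow> 'a \<Rightarrow> 'a \<Rightarrow> 'a) \<Rightarrow> (nat \<Rightarrow> 'a \<Rightarrow> 'a \<Rightarrow> 'a \<Rightarrow> 'a) \<Rightarrow> 'a rel \<Rightarrow> 'a rel \<Rightarrow> bool" where
  "rel_absorbs n d d' R R' \<longleftrightarrow> (\<forall>k\<le>n. \<forall>x x' y y' z z'. (x, x') \<in> R \<longrightarrow> (y, y') \<in> R' \<longrightarrow> (z, z') \<in> R \<longrightarrow>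
     (d k x y z, d' k x' y' z') \<in> R)"

lemma rel_absorbsD:
  "rel_absorbs n d d' R R' \<Longrightarrow> k \<le> n \<Longrightarrow> (x, x') \<in> R \<Longrightarrow> (y, y') \<in> R' \<Longrightarrow> (z, z') \<in> R \<Longrightarrow>
    (d k x y z, d' k x' y' z') \<in> R"
  unfolding rel_absorbs_def by blast

lemma rel_absorbs_mono: "rel_absorbs n d d' R R' \<Longrightarrow> Q \<subseteq> R' \<Longrightarrow> rel_absorbs n d d' R Q"
  unfolding rel_absorbs_def by blast

lemma rel_absorbs_comp:
  assumes "rel_absorbs n d d' R R'" "rel_absorbs n d' d'' Q Q'"
  shows "rel_absorbs n d d'' (R O Q) (R' O Q')"
  unfolding rel_absorbs_def
proof (intro allI impI)
  fix k x x' y y' z z'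
  assume *: "k \<le> n" "(x, x') \<in> R O Q" "(y, y') \<in> R' O Q'" "(z, z') \<in> R O Q"
  then obtain a b c where "(x, a) \<in> R" "(a, x') \<in> Q" "(y, b) \<in> R'" "(b, y') \<in> Q'" "(z, c) \<in> R" "(c, z') \<in> Q"
    by blast
  then show "(d k x y z, d'' k x' y' z') \<in> R O Q"
    using rel_absorbsD[OF assms(1) *(1)] rel_absorbsD[OF assms(2) *(1)] by blast
qed

lemma rel_absorbs_relpow:
  assumes "rel_absorbs n d d R R'"
  shows "0 < m \<Longrightarrow> rel_absorbs n d d (R ^^ m) (R' ^^ m)"
proof (induction m)
  case (Suc m)
  then show ?case using assms rel_absorbs_comp[of n d d "R ^^ m" "R' ^^ m" d R R'] by (cases m) auto
qed simp

text \<open>By the identities the edges from \<open>d k x x y\<close> to \<open>d k x y y\<close>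
  join up to an \<open>R\<close>-walk from \<open>x\<close> to \<open>y\<close>, and
  \<open>X\<close> cannot be left along \<open>R\<close>.\<close>

lemma jonsson_ops_path:
  assumes "jonsson_ops n D d" "x \<in> D" "y \<in> D"
    and R: "\<And>k. k \<le> n \<Longrightarrow> (d k x x y, d k x y y) \<in> R"
    and X: "R `` X \<subseteq> X" "x \<in> X"
  shows "y \<in> X"
proof -
  have "d k x x y \<in> X \<and> d k x y y \<in> X" if "k \<le> n" for k
    using that
  proof (induction k)
    case 0
    then have "d 0 x x y = x" using assms unfolding jonsson_ops_def by blast
    then show ?case using R[of 0] X by (metis Image_singleton_iff ImageI le0 subsetD)
  next
    case (Suc k)
    then have "d (Suc k) x x y = d k x y y" using assms(1-3) unfolding jonsson_ops_def
      by (simp add: Suc_le_eq)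
    with Suc show ?case using R[of "Suc k"] X(1) by (metis ImageI Suc_leD subsetD)
  qed
  from this[of n] show ?thesis using assms unfolding jonsson_ops_def by auto
qed

text \<open>Otherwise \<open>E\<close> would be well-founded on the finite set \<open>X\<close>, and
  a minimal element would have no predecessor.\<close>

lemma finite_predecessor_cycle:
  assumes "finite X" "X \<noteq> {}" "\<And>x. x \<in> X \<Longrightarrow> \<exists>y\<in>X. (y, x) \<in> E"
  shows "\<exists>a\<in>X. (a, a) \<in> (E \<inter> X \<times> X)\<^sup>+"
proof (rule ccontr)
  assume "\<not> ?thesis"
  then have "acyclic (E \<inter> X \<times> X)"
    unfolding acyclic_def by (metis IntD2 SigmaD1 converse_tranclE)
  then have "wf (E \<inter> X \<times> X)"
    using assms(1) by (intro finite_acyclic_wf) auto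
  from wf_eq_minimal[THEN iffD1, OF this, rule_format, OF] assms(2)
  obtain z where "z \<in> X" "\<And>y. (y, z) \<in> E \<inter> X \<times> X \<Longrightarrow> y \<notin> X" by (metis ex_in_conv)
  with assms(3)[of z] show False by blast
qed

text \<open>\<open>finite_predecessor_cycle\<close> is applied to the members of \<open>X\<close>
  from which \<open>b\<close> can be reached.\<close>

lemma recurrent_ancestor:
  assumes "finite X" "b \<in> X" "\<And>x. x \<in> X \<Longrightarrow> \<exists>y\<in>X. (y, x) \<in> E"
  shows "\<exists>c\<in>X. (c, c) \<in> E\<^sup>+ \<and> (c, b) \<in> E\<^sup>*"
proof -
  let ?Y = "{y\<in>X. (y, b) \<in> E\<^sup>*}"
  have "\<exists>a\<in>?Y. (a, a) \<in> (E \<inter> ?Y \<times> ?Y)\<^sup>+"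
    using assms by (intro finite_predecessor_cycle) (auto intro: converse_rtrancl_into_rtrancl)
  then show ?thesis by (auto dest: trancl_mono[OF _ Int_lower1])
qed

subsection \<open>A loop lemma\<close>

text \<open>With \<open>e\<^sub>j(t) = d\<^sub>j(w\<^sub>t, w\<^sub>t\<^sub>+\<^sub>1, w\<^sub>t\<^sub>+\<^sub>1)\<close> for a periodic walk \<open>w\<close>, using a loop of \<open>Id_on D\<close> in the
  middle gives an edge from \<open>e\<^sub>j(t)\<close> to \<open>e\<^sub>j\<^sub>-\<^sub>1(t + 1)\<close>; going from \<open>e\<^sub>n\<close> down to \<open>e\<^sub>0\<close> loses one step
  against \<open>w\<close>, so there is also a closed walk of length 1 modulo the period.\<close>

lemma absorbed_cycle_lengths:
  assumes chain: "jonsson_ops n D d" and E: "E \<subseteq> D \<times> D"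
    and abs: "rel_absorbs n d d E (E \<union> Id_on D)" and cyc: "(a, a) \<in> E\<^sup>+"
  shows "\<exists>M0. \<forall>M\<ge>M0. (a, a) \<in> E ^^ M"
proof -
  obtain k where k: "0 < k" "(a, a) \<in> E ^^ k" using cyc by (auto simp: trancl_power)
  then obtain f where f: "f 0 = a" "f k = a" "\<And>i. i < k \<Longrightarrow> (f i, f (Suc i)) \<in> E"
    unfolding relpow_fun_conv by blast
  define w where "w t = f (t mod k)" for t
  have w_step: "(w t, w (Suc t)) \<in> E" for t
  proof (cases "Suc (t mod k) = k")
    case True
    then have "w (Suc t) = f (Suc (t mod k))" by (simp add: w_def mod_Suc f)
    then show ?thesis using f(3)[of "t mod k"] k(1) by (simp add: w_def)
  next
    case False
    then have "w (Suc t) = f (Suc (t mod k))" by (simp add: w_def mod_Suc)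
    then show ?thesis using f(3)[of "t mod k"] k(1) by (simp add: w_def)
  qed
  then have w_D: "w t \<in> D" for t using E by blast
  have w_walk: "(w t, w (t + m)) \<in> E ^^ m" for t m
    using w_step by (induction m) auto
  have w_mult: "w (k * m) = a" for m using f by (simp add: w_def)
  define e where "e j t = d j (w t) (w (Suc t)) (w (Suc t))" for j t
  have e_step: "(e (Suc j) t, e j (Suc t)) \<in> E" if "j < n" for j t
  proof -
    have "(d (Suc j) (w t) (w (Suc t)) (w (Suc t)), d (Suc j) (w (Suc t)) (w (Suc t)) (w (Suc (Suc t)))) \<in> E"
      using that w_step w_D by (intro rel_absorbsD[OF abs]) auto
    moreover have "d (Suc j) (w (Suc t)) (w (Suc t)) (w (Suc (Suc t))) = e j (Suc t)"
      using chain that w_D unfolding jonsson_ops_def e_def by metis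
    ultimately show ?thesis by (simp add: e_def)
  qed
  have "(e j t, e 0 (t + j)) \<in> E ^^ j" if "j \<le> n" for j t
    using that
  proof (induction j arbitrary: t)
    case (Suc j)
    then have "(e j (Suc t), e 0 (Suc t + j)) \<in> E ^^ j" by (metis Suc_leD)
    with e_step[of j t] Suc.prems show ?case by (metis Suc_le_eq add_Suc_shift relpow_Suc_I2)
  qed simp
  \<comment> \<open>With \<open>t = k - 1\<close> the walk starts at \<open>w k = a\<close>; its
    \<open>n\<close> edges raise the index along \<open>w\<close> by only
    \<open>n - 1\<close>.\<close>
  from this[of n "k - 1"] have "(e n (k - 1), e 0 (k - 1 + n)) \<in> E ^^ n" by simp
  moreover have "e n (k - 1) = w k" "e 0 (k - 1 + n) = w (k - 1 + n)"
    using chain w_D k(1) unfolding jonsson_ops_def e_def by auto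
  ultimately have "(w k, w (k - 1 + n)) \<in> E ^^ n" by simp
  \<comment> \<open>Following \<open>w\<close> on to a multiple of \<open>k\<close> closes the walk
    at \<open>a\<close>, with total length \<open>k * n + 1\<close>.\<close>
  moreover have "(w (k - 1 + n), w (k * Suc n)) \<in> E ^^ (k * Suc n - (k - 1 + n))"
  proof -
    have "k - 1 + n \<le> k * Suc n" using k(1) by (cases k) auto
    then show ?thesis using w_walk[of "k - 1 + n" "k * Suc n - (k - 1 + n)"] by simp
  qed
  ultimately have "(w k, w (k * Suc n)) \<in> E ^^ (n + (k * Suc n - (k - 1 + n)))"
    by (metis relpow_add relcomp.relcompI)
  moreover have "n + (k * Suc n - (k - 1 + n)) = k * n + 1"
  proof -
    have "k - 1 + n \<le> k * Suc n" using k(1) by (cases k) auto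
    then show ?thesis using k(1) by simp
  qed
  ultimately have long: "(a, a) \<in> E ^^ (k * n + 1)"
    using w_mult[of 1] w_mult[of "Suc n"] by simp
  have rep: "(a, a) \<in> E ^^ (q * m)" if "(a, a) \<in> E ^^ m" for q m
  proof (induction q)
    case (Suc q)
    then have "(a, a) \<in> E ^^ (m + q * m)" unfolding relpow_add using that by blast
    then show ?case by simp
  qed simp
  \<comment> \<open>Since \<open>k * n + 1\<close> is 1 modulo \<open>k\<close>,
    \<open>M mod k\<close> rounds of the long walk give the right residue; rounds of length
    \<open>k\<close> fill up the rest.\<close>
  have "(a, a) \<in> E ^^ M" if M: "k * (k * n + 1) \<le> M" for M
  proof -
    define r where "r = M mod k"
    have "r * (k * n + 1) \<le> M"
      using M k(1) unfolding r_def by (meson le_trans less_imp_le_nat mod_less_divisor mult_le_mono1)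
    moreover have "r * (k * n + 1) mod k = M mod k" unfolding r_def
      by (simp add: algebra_simps mod_add_right_eq)
    ultimately have "k dvd M - r * (k * n + 1)" by (metis mod_eq_dvd_iff_nat)
    then obtain q where "M - r * (k * n + 1) = q * k" by (metis dvd_div_mult_self)
    with \<open>r * (k * n + 1) \<le> M\<close> have M_eq: "M = r * (k * n + 1) + q * k" by simp
    have "(a, a) \<in> E ^^ (r * (k * n + 1)) O E ^^ (q * k)"
      using rep[OF long, of r] rep[OF k(2), of q] by (rule relcompI)
    then show ?thesis unfolding relpow_add[symmetric] M_eq[symmetric] .
  qed
  then show ?thesis by blast
qed

lemma absorbed_cycle_has_loop:
  assumes "finite D" "jonsson_ops n D d"
    and "\<And>k x y z. k \<le> n \<Longrightarrow> x \<in> D \<Longrightarrow> y \<in> D \<Longrightarrow> z \<in> D \<Longrightarrow> d k x y z \<in> D"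
    and "E \<subseteq> D \<times> D" "rel_absorbs n d d E (E \<union> Id_on D)" "(a, a) \<in> E\<^sup>+"
  shows "\<exists>c. (c, c) \<in> E"
  using assms
proof (induction D arbitrary: E a rule: finite_psubset_induct)
  case (psubset D)
  note chain = psubset.prems(1) and closed = psubset.prems(2) and E = psubset.prems(3)
    and abs = psubset.prems(4) and cyc = psubset.prems(5)
  show ?case
  proof (rule ccontr)
    assume noloop: "\<nexists>c. (c, c) \<in> E"
    have nosub: "\<not> X \<subseteq> E `` X" if psub: "X \<subset> D" and ne: "X \<noteq> {}"
      and Xc: "\<And>k x y z. k \<le> n \<Longrightarrow> x \<in> X \<Longrightarrow> y \<in> X \<Longrightarrow> z \<in> X \<Longrightarrow> d k x y z \<in> X" for X
    proof
      assume sub: "X \<subseteq> E `` X"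
      have finX: "finite X" using psub psubset.hyps(1) finite_subset by blast
      then obtain c where c: "(c, c) \<in> (E \<inter> X \<times> X)\<^sup>+"
        using finite_predecessor_cycle[OF finX ne, of E] sub by blast
      have "rel_absorbs n d d (E \<inter> X \<times> X) (E \<inter> X \<times> X \<union> Id_on X)"
        unfolding rel_absorbs_def
      proof (intro allI impI)
        fix k x x' y y' z z'
        assume *: "k \<le> n" "(x, x') \<in> E \<inter> X \<times> X" "(y, y') \<in> E \<inter> X \<times> X \<union> Id_on X" "(z, z') \<in> E \<inter> X \<times> X"
        then have "(d k x y z, d k x' y' z') \<in> E"
          using psub by (intro rel_absorbsD[OF abs]) auto
        moreover have "d k x y z \<in> X" "d k x' y' z' \<in> X" using * Xc by auto
        ultimately show "(d k x y z, d k x' y' z') \<in> E \<inter> X \<times> X" by blast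
      qed
      moreover have "jonsson_ops n X d" using chain psub jonsson_ops_subset by blast
      ultimately have "\<exists>c. (c, c) \<in> E \<inter> X \<times> X"
        using psubset.IH[OF psub] Xc c by blast
      then show False using noloop by blast
    qed
    have aD: "a \<in> D" using cyc E by (metis SigmaD1 subsetD tranclD)
    obtain M0 where M0: "\<And>M. M0 \<le> M \<Longrightarrow> (a, a) \<in> E ^^ M"
      using absorbed_cycle_lengths[OF chain E abs cyc] by blast
    define X where "X i = (E ^^ i) `` {a}" for i
    have X0: "X 0 = {a}" by (simp add: X_def)
    have XS: "X (Suc i) = E `` X i" for i by (auto simp: X_def)
    have XD: "X i \<subseteq> D" for i using aD E by (induction i) (auto simp: X0 XS)
    have Xne: "X i \<noteq> {}" for i
    proof -
      have "X (i + M0) \<noteq> {}" using M0[of "i + M0"] by (auto simp: X_def)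
      moreover have "X (i + j) = {}" if "X i = {}" for j using that by (induction j) (auto simp: XS)
      ultimately show ?thesis by blast
    qed
    have Xclosed: "d k x y z \<in> X i" if "k \<le> n" "x \<in> X i" "y \<in> X i" "z \<in> X i" for k x y z i
      using that(2-4)
    proof (induction i arbitrary: x y z)
      case 0
      then show ?case using jonsson_ops_idem[OF chain aD that(1)] by (simp add: X0)
    next
      case (Suc i)
      then obtain x' y' z' where "x' \<in> X i" "(x', x) \<in> E" "y' \<in> X i" "(y', y) \<in> E" "z' \<in> X i" "(z', z) \<in> E"
        by (auto simp: XS)
      then show ?case using Suc.IH[of x' y' z'] rel_absorbsD[OF abs that(1), of x' x y' y z' z]
        by (auto simp: XS)
    qed
    have "X i \<noteq> D" for i
    proof (induction i)
      case 0
      show ?case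
      proof
        assume "X 0 = D"
        then have "(a, a) \<in> E" using cyc E X0 by (metis SigmaD1 SigmaD2 singletonD subsetD tranclD)
        then show False using noloop by blast
      qed
    next
      case (Suc i)
      then have "X i \<subset> D" using XD[of i] by blast
      then have "\<not> X i \<subseteq> E `` X i" using Xne Xclosed by (rule nosub)
      then show ?case using XD[of i] by (auto simp: XS)
    qed
    then have "X i \<subset> D" for i using XD[of i] by blast
    then have notsub: "\<not> X i \<subseteq> X (Suc i)" for i
      using nosub[OF _ Xne Xclosed, of i] by (simp add: XS)
    have mono: "X i \<subseteq> X (i + j)" if "M0 \<le> j" for i j
      using M0[OF that] unfolding X_def add.commute[of i] relpow_add by blast
    have finX: "finite (X i)" for i using XD psubset.hyps(1) finite_subset by blast
    have "card (X i) \<le> card D" for i using XD psubset.hyps(1) card_mono by blast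
    then obtain i where i: "\<And>j. card (X j) \<le> card (X i)"
      using ex_has_greatest_nat[of "\<lambda>_. True" 0 "\<lambda>i. card (X i)" "Suc (card D)"]
      by (auto simp: less_Suc_eq_le)
    have stable: "X (i + j) = X i" if "M0 \<le> j" for j
      using mono[OF that, of i] i[of "i + j"] finX by (metis card_seteq)
    have "X (Suc (i + M0)) = X i" using stable[of "Suc M0"] by (simp only: add_Suc_right le_SucI order_refl)
    with stable[OF order_refl] show False using notsub[of "i + M0"] by (metis order_refl)
  qed
qed

subsection \<open>Shrinking arc consistent domains\<close>

text \<open>\<open>S\<close> is the set of global solutions, and the constraint with scope
  \<open>C\<close> consists of the restrictions of members of \<open>S\<close> to \<open>C\<close>.
  A member of \<open>S\<close> need not respect the domains \<open>D\<close>; such a solution is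
  allowed only as the middle argument. The operations depend on the variable because a retraction
  may act differently at each variable.\<close>

locale absorbing_instance =
  fixes n :: nat and V :: "'v set" and S :: "('v \<Rightarrow> 'a) set" and CC :: "'v set set"
    and D :: "'v \<Rightarrow> 'a set" and d :: "nat \<Rightarrow> 'v \<Rightarrow> 'a \<Rightarrow> 'a \<Rightarrow> 'a \<Rightarrow> 'a"
  assumes finite_V: "finite V"
    and scopes: "\<Union> CC = V" "{} \<notin> CC"
    and finite_D: "v \<in> V \<Longrightarrow> finite (D v)"
    and D_nonempty: "v \<in> V \<Longrightarrow> D v \<noteq> {}"
    and arc_consistent: "C \<in> CC \<Longrightarrow> v \<in> C \<Longrightarrow> a \<in> D v \<Longrightarrow> \<exists>s\<in>S. s v = a \<and> (\<forall>w\<in>C. s w \<in> D w)"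
    and compatible: "C \<in> CC \<Longrightarrow> k \<le> n \<Longrightarrow> r \<in> S \<Longrightarrow> (\<forall>w\<in>C. r w \<in> D w) \<Longrightarrow> q \<in> S \<Longrightarrow> (\<forall>w\<in>C. q w \<in> D w) \<Longrightarrow> p \<in> S \<Longrightarrow>
      \<exists>s\<in>S. \<forall>w\<in>C. s w = d k w (r w) (p w) (q w) \<and> s w \<in> D w"
    and chain: "v \<in> V \<Longrightarrow> jonsson_ops n (D v) (\<lambda>k. d k v)"
begin

section \<open>Local solutions and transport of subsets along walks\<close>

definition loc :: "'v set \<Rightarrow> ('v \<Rightarrow> 'a) set" where
  "loc C = {s \<in> S. \<forall>w\<in>C. s w \<in> D w}"

definition img :: "'v set \<Rightarrow> 'v \<Rightarrow> 'v \<Rightarrow> 'a set \<Rightarrow> 'a set" where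
  "img C v u X = {s u |s. s \<in> loc C \<and> s v \<in> X}"

definition node :: "'v \<Rightarrow> 'a set \<Rightarrow> bool" where
  "node v X \<longleftrightarrow> v \<in> V \<and> X \<subset> D v \<and> X \<noteq> {} \<and> (\<forall>k\<le>n. \<forall>x\<in>X. \<forall>z\<in>X. \<forall>p\<in>S. d k v x (p v) z \<in> X)"

text \<open>\<open>F\<close> collects the pairs joined along the walk by local solutions, chosen
  anew for each constraint, and \<open>F'\<close> those joined in the same way by arbitrary members
  of \<open>S\<close>. A walk may not continue to a whole domain, so only proper subsets are
  visited.\<close>

inductive walk :: "'v \<Rightarrow> 'a set \<Rightarrow> 'v \<Rightarrow> 'a set \<Rightarrow> 'a rel \<Rightarrow> 'a rel \<Rightarrow> bool" where
  refl: "node v X \<Longrightarrow> walk v X v X (Id_on (D v)) (Id_on {s v |s. s \<in> S})"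
| step: "walk v X u Z F F' \<Longrightarrow> C \<in> CC \<Longrightarrow> u \<in> C \<Longrightarrow> w \<in> C \<Longrightarrow> img C u w Z \<noteq> D w \<Longrightarrow>
    walk v X w (img C u w Z) (F O {(s u, s w) |s. s \<in> loc C}) (F' O {(s u, s w) |s. s \<in> S})"

abbreviation reach :: "'v \<Rightarrow> 'a set \<Rightarrow> 'v \<Rightarrow> 'a set \<Rightarrow> bool" where
  "reach v X u Z \<equiv> \<exists>F F'. walk v X u Z F F'"

lemma locD: "s \<in> loc C \<Longrightarrow> s \<in> S" "s \<in> loc C \<Longrightarrow> w \<in> C \<Longrightarrow> s w \<in> D w"
  by (auto simp: loc_def)

lemma loc_arc: "C \<in> CC \<Longrightarrow> v \<in> C \<Longrightarrow> a \<in> D v \<Longrightarrow> \<exists>s\<in>loc C. s v = a"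
  using arc_consistent[of C v a] by (auto simp: loc_def)

lemma loc_op:
  assumes "C \<in> CC" "k \<le> n" "r \<in> loc C" "q \<in> loc C" "p \<in> S"
  shows "\<exists>s\<in>loc C. \<forall>w\<in>C. s w = d k w (r w) (p w) (q w)"
proof -
  have "\<exists>s\<in>S. \<forall>w\<in>C. s w = d k w (r w) (p w) (q w) \<and> s w \<in> D w"
    using assms by (intro compatible) (auto simp: loc_def)
  then show ?thesis unfolding loc_def by blast
qed

lemma D_global: "v \<in> V \<Longrightarrow> a \<in> D v \<Longrightarrow> \<exists>s\<in>S. s v = a"
  using scopes(1) arc_consistent by blast

lemma img_subset: "C \<in> CC \<Longrightarrow> u \<in> C \<Longrightarrow> img C v u X \<subseteq> D u"
  by (auto simp: img_def dest: locD)

lemma node_img: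
  assumes "node v X" "C \<in> CC" "v \<in> C" "u \<in> C" "img C v u X \<noteq> D u"
  shows "node u (img C v u X)"
  unfolding node_def
proof (intro conjI allI ballI impI)
  show "u \<in> V" using assms scopes by blast
  show "img C v u X \<subset> D u" using img_subset assms by blast
  obtain x where "x \<in> X" "x \<in> D v" using assms(1) unfolding node_def by blast
  then show "img C v u X \<noteq> {}" using loc_arc[OF assms(2,3)] unfolding img_def by blast
  fix k x z p assume *: "k \<le> n" "x \<in> img C v u X" "z \<in> img C v u X" "p \<in> S"
  then obtain s t where s: "s \<in> loc C" "s v \<in> X" "x = s u" and t: "t \<in> loc C" "t v \<in> X" "z = t u"
    unfolding img_def by blast
  obtain r where r: "r \<in> loc C" "\<And>w. w \<in> C \<Longrightarrow> r w = d k w (s w) (p w) (t w)"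
    using loc_op[OF assms(2) *(1) s(1) t(1) *(4)] by blast
  have "r v \<in> X" using r(2)[OF assms(3)] assms(1) s(2) t(2) * unfolding node_def by simp
  moreover have "d k u x (p u) z = r u" using r(2)[OF assms(4)] s(3) t(3) by simp
  ultimately show "d k u x (p u) z \<in> img C v u X" using r(1) unfolding img_def by blast
qed

lemma walk_node: "walk v X u Z F F' \<Longrightarrow> node v X \<and> node u Z"
  by (induction rule: walk.induct) (auto intro: node_img)

lemma walk_image: "walk v X u Z F F' \<Longrightarrow> Z = F `` X"
proof (induction rule: walk.induct)
  case (refl v X)
  then show ?case unfolding node_def by auto
next
  case (step v X u Z F F' C w)
  then show ?case unfolding img_def by blast
qed

lemma walk_subset: "walk v X u Z F F' \<Longrightarrow> F \<subseteq> D v \<times> D u"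
proof (induction rule: walk.induct)
  case (step v X u Z F F' C w)
  then show ?case by (auto dest: locD)
qed auto

lemma walk_global_subset: "walk v X u Z F F' \<Longrightarrow> F' \<subseteq> {s v |s. s \<in> S} \<times> {s u |s. s \<in> S}"
  by (induction rule: walk.induct) auto

lemma walk_le: "walk v X u Z F F' \<Longrightarrow> F \<subseteq> F'"
proof (induction rule: walk.induct)
  case (refl v X)
  then show ?case using D_global unfolding node_def by (auto simp: Id_on_iff)
next
  case (step v X u Z F F' C w)
  then show ?case by (auto dest: locD)
qed

lemma walk_pred: "walk v X u Z F F' \<Longrightarrow> b \<in> D u \<Longrightarrow> \<exists>a\<in>D v. (a, b) \<in> F"
proof (induction arbitrary: b rule: walk.induct)
  case (step v X u Z F F' C w)
  then obtain s where "s \<in> loc C" "s w = b" using loc_arc by blast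
  then show ?case using step.IH[of "s u"] step.hyps locD(2)[of s C u] by blast
qed auto

text \<open>The same global solution serves at every step of the walk.\<close>

lemma walk_global: "walk v X u Z F F' \<Longrightarrow> s \<in> S \<Longrightarrow> (s v, s u) \<in> F'"
  by (induction rule: walk.induct) auto

lemma op_in_D:
  assumes "v \<in> V" "k \<le> n" "x \<in> D v" "z \<in> D v" "p \<in> S"
  shows "d k v x (p v) z \<in> D v"
proof -
  obtain C where C: "C \<in> CC" "v \<in> C" using scopes assms(1) by blast
  obtain s t where s: "s \<in> loc C" "s v = x" and t: "t \<in> loc C" "t v = z"
    using loc_arc[OF C assms(3)] loc_arc[OF C assms(4)] by blast
  obtain r where "r \<in> loc C" "\<And>w. w \<in> C \<Longrightarrow> r w = d k w (s w) (p w) (t w)"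
    using loc_op[OF C(1) assms(2) s(1) t(1) assms(5)] by blast
  then show ?thesis using locD(2)[of r C v] C(2) s(2) t(2) by simp
qed

lemma walk_absorbs: "walk v X u Z F F' \<Longrightarrow> rel_absorbs n (\<lambda>k. d k v) (\<lambda>k. d k u) F F'"
proof (induction rule: walk.induct)
  case (refl v X)
  then show ?case using op_in_D unfolding rel_absorbs_def node_def by auto
next
  case (step v X u Z F F' C w)
  have "rel_absorbs n (\<lambda>k. d k u) (\<lambda>k. d k w) {(s u, s w) |s. s \<in> loc C} {(s u, s w) |s. s \<in> S}"
    unfolding rel_absorbs_def
  proof (intro allI impI)
    fix k x x' y y' z z'
    assume *: "k \<le> n" "(x, x') \<in> {(s u, s w) |s. s \<in> loc C}" "(y, y') \<in> {(s u, s w) |s. s \<in> S}"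
      "(z, z') \<in> {(s u, s w) |s. s \<in> loc C}"
    then obtain r p q where r: "r \<in> loc C" "x = r u" "x' = r w" and p: "p \<in> S" "y = p u" "y' = p w"
      and q: "q \<in> loc C" "z = q u" "z' = q w" by blast
    obtain s where "s \<in> loc C" "\<And>w. w \<in> C \<Longrightarrow> s w = d k w (r w) (p w) (q w)"
      using loc_op[OF step.hyps(2) *(1) r(1) q(1) p(1)] by blast
    then show "(d k u x y z, d k w x' y' z') \<in> {(s u, s w) |s. s \<in> loc C}"
      using r p q step.hyps by force
  qed
  with step.IH show ?case by (rule rel_absorbs_comp)
qed

lemma walk_trans:
  assumes "walk u Z w Y G G'" "walk v X u Z F F'"
  shows "walk v X w Y (F O G) (F' O G')"
  using assms
proof (induction arbitrary: F F' rule: walk.induct)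
  case (refl u Z)
  have "F O Id_on (D u) = F" "F' O Id_on {s u |s. s \<in> S} = F'"
    using walk_subset[OF refl(2)] walk_global_subset[OF refl(2)] by auto
  with refl show ?case by simp
next
  case (step u Z x T G G' C w)
  show ?case using walk.step[OF step.IH[OF step.prems] step.hyps(2-5)] by (simp only: O_assoc)
qed

lemma reach_trans: "reach v X u Z \<Longrightarrow> reach u Z w Y \<Longrightarrow> reach v X w Y"
  using walk_trans by blast

section \<open>Values reached by global solutions inside a component\<close>

text \<open>These values are reached through \<open>F'\<close> and may lie outside
  \<open>D w\<close>; those of \<open>spread u Z u Z\<close> inside \<open>D u\<close> turn out to
  lie in \<open>Z\<close>.\<close>

definition spread :: "'v \<Rightarrow> 'a set \<Rightarrow> 'v \<Rightarrow> 'a set \<Rightarrow> 'a set" where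
  "spread u Z w W = {b. \<exists>F F' x. walk u Z w W F F' \<and> x \<in> Z \<and> (x, b) \<in> F'}"

lemma spread_walk:
  assumes "b \<in> spread u Z w W" "walk w W w' W' F F'" "(b, c) \<in> F'"
  shows "c \<in> spread u Z w' W'"
  using assms walk_trans unfolding spread_def by blast

text \<open>The member of \<open>S\<close> that witnesses the last step also follows a walk from its
  end back to its start, which exists inside the component. So each step can be undone by walking
  forward.\<close>

lemma spread_back:
  assumes "walk w W w' W' G G'" "reach u Z w W" "reach w' W' u Z" "(c, b) \<in> G'" "b \<in> spread u Z w' W'"
  shows "c \<in> spread u Z w W"
  using assms
proof (induction arbitrary: b rule: walk.induct)
  case (refl v X)
  then show ?case by auto
next
  case (step w W v X F F' C v')
  from step.prems(3) obtain s where s: "(c, s v) \<in> F'" "b = s v'" "s \<in> S" by blast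
  note next_walk = walk.step[OF walk.refl step.hyps(2-5)]
  have node: "node v X" using walk_node[OF step.hyps(1)] by blast
  have "reach v' (img C v v' X) v X"
    using step.prems(1,2) step.hyps(1) reach_trans by meson
  then obtain H H' where H: "walk v' (img C v v' X) v X H H'" by blast
  then have "s v \<in> spread u Z v X"
    using spread_walk[OF step.prems(4) H] walk_global[OF H s(3)] s(2) by simp
  moreover have "reach v X u Z" using next_walk[OF node] step.prems(2) reach_trans by meson
  ultimately show ?case using step.IH[OF step.prems(1)] s(1) by blast
qed

text \<open>Closed walks at \<open>(u, Z)\<close> can be concatenated, and every value in
  \<open>D u\<close> is taken by a global solution and is thus related to itself along each of them.
  So one walk serves all of \<open>T\<close>.\<close>

lemma spread_uniform:
  assumes "node u Z" "finite T" "T \<subseteq> spread u Z u Z" "T \<subseteq> D u"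
  shows "\<exists>F F'. walk u Z u Z F F' \<and> (\<forall>b\<in>T. \<exists>x\<in>Z. (x, b) \<in> F')"
  using assms(2,3,4)
proof (induction T)
  case empty
  then show ?case using walk.refl[OF assms(1)] by blast
next
  case (insert b T)
  then obtain F F' where F: "walk u Z u Z F F'" "\<forall>b\<in>T. \<exists>x\<in>Z. (x, b) \<in> F'" by auto
  obtain G G' x where G: "walk u Z u Z G G'" "x \<in> Z" "(x, b) \<in> G'"
    using insert.prems unfolding spread_def by blast
  have self: "(a, a) \<in> H'" if "a \<in> D u" "walk u Z u Z H H'" for a H H'
    using D_global[of u a] assms(1) walk_global[OF that(2)] that(1) unfolding node_def by blast
  have "walk u Z u Z (F O G) (F' O G')" using walk_trans[OF G(1) F(1)] .
  moreover have "\<exists>x\<in>Z. (x, c) \<in> F' O G'" if "c \<in> insert b T" for c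
  proof (cases "c = b")
    case True
    have "x \<in> D u" using G(2) assms(1) unfolding node_def by blast
    then show ?thesis using True self[OF _ F(1)] G by blast
  next
    case False
    then show ?thesis using F(2) that self[OF _ G(1), of c] insert.prems by blast
  qed
  ultimately show ?case by blast
qed

text \<open>A local value \<open>b\<close> reached from \<open>Z\<close> by global solutions has an ancestor \<open>b'\<close> on a local cycle, which
  is again reached from \<open>Z\<close>.  The Jonsson operations applied to a local loop at some \<open>x' \<in> Z\<close>, a global
  walk from \<open>x'\<close> to \<open>b'\<close> and a local loop at \<open>b'\<close> turn the global walk into a local one, along which
  \<open>Z\<close> is closed.\<close>

lemma spread_local:
  assumes node: "node u Z"
  shows "spread u Z u Z \<inter> D u \<subseteq> Z"
proof
  fix b assume b: "b \<in> spread u Z u Z \<inter> D u"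
  have u: "u \<in> V" and fin: "finite (D u)" and ZD: "Z \<subseteq> D u"
    using node finite_D unfolding node_def by auto
  obtain F F' where F: "walk u Z u Z F F'" and cover: "\<And>b. b \<in> spread u Z u Z \<inter> D u \<Longrightarrow> \<exists>x\<in>Z. (x, b) \<in> F'"
    using spread_uniform[OF node, of "spread u Z u Z \<inter> D u"] fin by blast
  have FZ: "Z = F `` Z" using walk_image[OF F] .
  obtain b' where b': "b' \<in> D u" "(b', b') \<in> F\<^sup>+" "(b', b) \<in> F\<^sup>*"
    using recurrent_ancestor[of "D u" b F] fin b walk_pred[OF F] by blast
  \<comment> \<open>As \<open>F \<subseteq> F'\<close>, the local path from \<open>b'\<close> to
    \<open>b\<close> can be traced backwards with \<open>spread_back\<close>.\<close>
  have "(b', b) \<in> F\<^sup>* \<Longrightarrow> b' \<in> spread u Z u Z"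
  proof (induction rule: converse_rtrancl_induct)
    case base
    then show ?case using b by blast
  next
    case (step y z)
    then show ?case using spread_back[OF F] F walk_le[OF F] by blast
  qed
  then have b'_spread: "b' \<in> spread u Z u Z \<inter> D u" using b' by blast
  then obtain x where x: "x \<in> Z" "(x, b') \<in> F'" using cover by blast
  obtain x' where x': "x' \<in> Z" "(x', x') \<in> F\<^sup>+" "(x', x) \<in> F\<^sup>*"
    using recurrent_ancestor[of Z x F] x(1) FZ finite_subset[OF ZD fin] by blast
  have self: "(a, a) \<in> F'" if "a \<in> D u" for a
    using D_global[OF u that] walk_global[OF F] by blast
  obtain i j l where i: "0 < i" "(x', x') \<in> F ^^ i" and j: "0 < j" "(b', b') \<in> F ^^ j" and l: "(x', x) \<in> F ^^ l"
    using x'(2,3) b'(2) by (auto simp: trancl_power rtrancl_power)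
  \<comment> \<open>A common multiple of both loop lengths that is at least \<open>Suc l\<close>;
    the global walk from \<open>x'\<close> to \<open>b'\<close> is padded to this length by staying
    at \<open>b'\<close>.\<close>
  define M where "M = i * j * Suc l"
  have rep: "(a, a) \<in> F ^^ (m * q)" if "(a, a) \<in> F ^^ m" for a m q
  proof (induction q)
    case (Suc q)
    then have "(a, a) \<in> F ^^ (m + m * q)" unfolding relpow_add using that by blast
    then show ?case by simp
  qed simp
  have loop_x: "(x', x') \<in> F ^^ M" using rep[OF i(2), of "j * Suc l"] by (simp only: M_def mult.assoc)
  have loop_b: "(b', b') \<in> F ^^ M" using rep[OF j(2), of "i * Suc l"] by (simp only: M_def ac_simps)
  have link: "(x', b') \<in> F' ^^ M"
  proof -
    have "F ^^ l \<subseteq> F' ^^ l" using walk_le[OF F] by (induction l) auto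
    then have "(x', x) \<in> F' ^^ l" using l by blast
    then have "(x', b') \<in> F' ^^ Suc l" using x(2) by auto
    then have "(x', b') \<in> F' ^^ (Suc l + m)" for m
      using self[OF b'(1)] by (induction m) auto
    moreover have "1 * Suc l \<le> M" unfolding M_def using i(1) j(1) by (intro mult_le_mono1) (simp add: Suc_le_eq)
    then have "Suc l + (M - Suc l) = M" by simp
    ultimately show ?thesis by metis
  qed
  have "rel_absorbs n (\<lambda>k. d k u) (\<lambda>k. d k u) (F ^^ M) (F' ^^ M)"
    using rel_absorbs_relpow[OF walk_absorbs[OF F]] i(1) j(1) by (simp add: M_def)
  then have path: "(d k u x' x' b', d k u x' b' b') \<in> F ^^ M" if "k \<le> n" for k
    by (rule rel_absorbsD[OF _ that loop_x link loop_b])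
  have inv: "y \<in> Z" if "(x, y) \<in> F ^^ m" "x \<in> Z" for x y m
    using that FZ by (induction m arbitrary: y) auto
  have "b' \<in> Z"
    using jonsson_ops_path[OF chain[OF u] _ b'(1) path, where X = Z] x'(1) ZD inv by blast
  moreover obtain m where "(b', b) \<in> F ^^ m" using b'(3) by (auto simp: rtrancl_power)
  ultimately show "b \<in> Z" using inv by blast
qed

text \<open>The value \<open>s v\<close> is reached from \<open>Z\<close> by a walk inside the
  component, and \<open>s\<close> itself follows the walk back to \<open>u\<close>;
  \<open>spread_local\<close> applies to \<open>s u\<close>.\<close>

lemma component_transfer:
  assumes "reach v X u Z" "reach u Z v X" "s \<in> S" "s v \<in> X" "s u \<in> D u"
  shows "s u \<in> Z"
proof -
  obtain F F' G G' where F: "walk v X u Z F F'" and G: "walk u Z v X G G'" using assms by blast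
  obtain z where "z \<in> Z" "(z, s v) \<in> G'"
    using walk_image[OF G] walk_le[OF G] assms(4) by blast
  then have "s v \<in> spread u Z v X" using G unfolding spread_def by blast
  then have "s u \<in> spread u Z u Z" using spread_walk F walk_global[OF F assms(3)] by blast
  then show ?thesis using spread_local walk_node[OF F] assms(5) by blast
qed


end

text \<open>By the pigeonhole principle the iterates on \<open>Z\<close> become periodic;
  \<open>K\<close> is a multiple of the period \<open>p\<close> that is at least the preperiod
  \<open>i\<close>.\<close>

lemma finite_idempotent_power:
  assumes "finite Z" "\<And>z. z \<in> Z \<Longrightarrow> F z \<in> Z"
  shows "\<exists>K>0. \<forall>z\<in>Z. (F ^^ K) ((F ^^ K) z) = (F ^^ K) z"
proof -
  have in_Z: "(F ^^ i) z \<in> Z" if "z \<in> Z" for i z using that assms(2) by (induction i) auto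
  let ?g = "\<lambda>i. restrict (F ^^ i) Z"
  have "range ?g \<subseteq> Z \<rightarrow>\<^sub>E Z" using in_Z by auto
  then have "finite (range ?g)" using assms(1) finite_PiE[of Z "\<lambda>_. Z"] finite_subset by blast
  then have "\<not> inj ?g" using finite_imageD by blast
  then obtain i j where ij: "i < j" "?g i = ?g j" unfolding inj_def by (metis linorder_neqE_nat)
  define p where "p = j - i"
  have period: "(F ^^ (m + p)) z = (F ^^ m) z" if "z \<in> Z" "i \<le> m" for m z
  proof -
    have "(F ^^ i) z = (F ^^ j) z" using ij(2) that(1) by (metis restrict_apply')
    then have "(F ^^ (m - i + j)) z = (F ^^ (m - i + i)) z" by (simp only: funpow_add comp_apply)
    then show ?thesis using that(2) ij(1) by (simp add: p_def)
  qed
  have periods: "(F ^^ (m + q * p)) z = (F ^^ m) z" if "z \<in> Z" "i \<le> m" for m q z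
  proof (induction q)
    case (Suc q)
    have "m + Suc q * p = (m + q * p) + p" by simp
    then show ?case using period[OF that(1), of "m + q * p"] that(2) Suc by (metis le_add1 le_trans)
  qed simp
  define K where "K = Suc i * p"
  have "0 < p" using ij(1) by (simp add: p_def)
  then have "Suc i * 1 \<le> K" unfolding K_def by (intro mult_le_mono2) simp
  then have "0 < K" "i \<le> K" by auto
  moreover have "(F ^^ K) ((F ^^ K) z) = (F ^^ K) z" if "z \<in> Z" for z
    using periods[OF that \<open>i \<le> K\<close>, of "Suc i"] by (simp only: K_def[symmetric] funpow_add comp_apply)
  ultimately show ?thesis by blast
qed

section \<open>Shrinking the domains\<close>

context absorbing_instance
begin

text \<open>Among the finitely many nodes, one that reaches the fewest is taken; whatever it reaches
  must reach equally many, hence also the node itself.\<close>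

lemma sink_exists:
  assumes "node v X"
  shows "\<exists>u Z. node u Z \<and> (\<forall>w W. reach u Z w W \<longrightarrow> reach w W u Z)"
proof -
  define R where "R p = {q. reach (fst p) (snd p) (fst q) (snd q)}" for p
  have fin: "finite (R p)" for p
  proof (rule finite_subset)
    show "R p \<subseteq> (SIGMA w:V. Pow (D w))"
      using walk_node unfolding R_def node_def by fastforce
    show "finite (SIGMA w:V. Pow (D w))" using finite_V finite_D by blast
  qed
  obtain p where p: "node (fst p) (snd p)" "\<And>q. node (fst q) (snd q) \<Longrightarrow> card (R p) \<le> card (R q)"
    using ex_has_least_nat[of "\<lambda>p. node (fst p) (snd p)" "(v, X)" "\<lambda>p. card (R p)"] assms by auto
  have "reach w W (fst p) (snd p)" if "reach (fst p) (snd p) w W" for w W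
  proof -
    have "R (w, W) \<subseteq> R p"
    proof
      fix q assume "q \<in> R (w, W)"
      then have "reach w W (fst q) (snd q)" by (simp add: R_def)
      with that show "q \<in> R p" unfolding R_def using reach_trans by blast
    qed
    moreover have "node w W" using that walk_node by blast
    ultimately have "R (w, W) = R p" using card_seteq[OF fin] p(2)[of "(w, W)"] by simp
    moreover have "p \<in> R p" using walk.refl[OF p(1)] by (auto simp: R_def)
    ultimately have "p \<in> R (w, W)" by simp
    then show ?thesis by (simp add: R_def)
  qed
  then show ?thesis using p(1) by blast
qed

text \<open>All subsets that the component of a sink has at the same variable coincide by
  \<open>component_transfer\<close>. The new domain is this subset where the component has one, and
  the old domain elsewhere.\<close>

lemma shrink_to_component:
  assumes "node v X"
  shows "\<exists>D'. absorbing_instance n V S CC D' d \<and> (\<forall>w\<in>V. D' w \<subseteq> D w) \<and> (\<exists>w\<in>V. D' w \<noteq> D w)"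
proof -
  obtain u Z where u: "node u Z" and sink: "\<And>w W. reach u Z w W \<Longrightarrow> reach w W u Z"
    using sink_exists[OF assms] by blast
  define D' where "D' w = {a \<in> D w. \<forall>W. reach u Z w W \<longrightarrow> a \<in> W}" for w
  have transfer: "s w' \<in> W'"
    if "reach u Z w W" "reach u Z w' W'" "s \<in> S" "s w \<in> W" "s w' \<in> D w'" for s w W w' W'
    using component_transfer[OF reach_trans[OF sink[OF that(1)] that(2)] reach_trans[OF sink[OF that(2)] that(1)] that(3-5)] .
  have D'_eq: "D' w = W" if "reach u Z w W" for w W
  proof
    show "D' w \<subseteq> W" using that by (auto simp: D'_def)
    have W: "node w W" using that walk_node by blast
    show "W \<subseteq> D' w"
    proof
      fix a assume "a \<in> W"
      then have "a \<in> D w" using W unfolding node_def by blast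
      then obtain s where s: "s \<in> S" "s w = a" using D_global W unfolding node_def by blast
      have "a \<in> W'" if "reach u Z w W'" for W'
        using transfer[OF \<open>reach u Z w W\<close> that s(1)] s(2) \<open>a \<in> W\<close> \<open>a \<in> D w\<close> by simp
      then show "a \<in> D' w" using \<open>a \<in> D w\<close> by (simp add: D'_def)
    qed
  qed
  have sub: "D' w \<subseteq> D w" for w by (auto simp: D'_def)
  have arc': "\<exists>s\<in>S. s w = a \<and> (\<forall>x\<in>C. s x \<in> D' x)" if C: "C \<in> CC" "w \<in> C" "a \<in> D' w" for C w a
  proof -
    \<comment> \<open>A local solution that lies in the component at one variable of the scope lies
      in it at all of them.\<close>
    have inD': "\<forall>y\<in>C. s y \<in> D' y" if "s \<in> loc C" "x \<in> C" "reach u Z x Y" "s x \<in> Y" for s x Y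
      using transfer[OF that(3) _ locD(1)[OF that(1)] that(4)] locD(2)[OF that(1)] by (auto simp: D'_def)
    consider (own) W where "reach u Z w W"
      | (other) x Y where "\<nexists>W. reach u Z w W" "x \<in> C" "reach u Z x Y"
      | (none) "\<nexists>x Y. x \<in> C \<and> reach u Z x Y" by blast
    then show ?thesis
    proof cases
      case own
      obtain s where s: "s \<in> loc C" "s w = a" using loc_arc[OF C(1,2)] C(3) sub by blast
      then show ?thesis using inD'[OF s(1) C(2) own] D'_eq[OF own] C(3) locD(1) by blast
    next
      case other
      \<comment> \<open>Otherwise the walk could be continued to \<open>w\<close>, which the
        component does not meet.\<close>
      have "img C x w Y = D w"
      proof (rule ccontr)
        assume "img C x w Y \<noteq> D w"
        then have "reach u Z w (img C x w Y)" using other(2,3) walk.step[OF _ C(1) other(2) C(2)] by blast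
        then show False using other(1) by blast
      qed
      then have "a \<in> img C x w Y" using C(3) sub by blast
      then obtain s where s: "s \<in> loc C" "s x \<in> Y" "s w = a" unfolding img_def by blast
      then show ?thesis using inD'[OF s(1) other(2,3) s(2)] locD(1) by blast
    next
      case none
      obtain s where s: "s \<in> loc C" "s w = a" using loc_arc[OF C(1,2)] C(3) sub by blast
      have "D' y = D y" if "y \<in> C" for y using none that by (auto simp: D'_def)
      then show ?thesis using s locD by blast
    qed
  qed
  have compat': "\<exists>s\<in>S. \<forall>w\<in>C. s w = d k w (r w) (p w) (q w) \<and> s w \<in> D' w"
    if C: "C \<in> CC" "k \<le> n" and r: "r \<in> S" "\<forall>w\<in>C. r w \<in> D' w" and q: "q \<in> S" "\<forall>w\<in>C. q w \<in> D' w"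
      and p: "p \<in> S" for C k r q p
  proof -
    have "r \<in> loc C" "q \<in> loc C" using r q sub by (auto simp: loc_def)
    then obtain s where s: "s \<in> loc C" "\<forall>w\<in>C. s w = d k w (r w) (p w) (q w)"
      using loc_op[OF C _ _ p] by blast
    have "s w \<in> D' w" if "w \<in> C" for w
    proof -
      have "s w \<in> W" if W: "reach u Z w W" for W
      proof -
        have "node w W" using W walk_node by blast
        moreover have "r w \<in> W" "q w \<in> W" using r(2) q(2) \<open>w \<in> C\<close> D'_eq[OF W] by auto
        ultimately show ?thesis using s(2) \<open>w \<in> C\<close> C(2) p unfolding node_def by simp
      qed
      then show ?thesis using locD(2)[OF s(1) that] by (simp add: D'_def)
    qed
    then show ?thesis using s locD(1) by blast
  qed
  have "absorbing_instance n V S CC D' d"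
  proof
    show "finite V" "\<Union> CC = V" "{} \<notin> CC" using finite_V scopes by auto
    show "finite (D' w)" if "w \<in> V" for w using finite_D[OF that] sub finite_subset by blast
    show "D' w \<noteq> {}" if "w \<in> V" for w
    proof (cases "\<exists>W. reach u Z w W")
      case True
      then obtain W where "reach u Z w W" by blast
      then show ?thesis using D'_eq walk_node unfolding node_def by blast
    next
      case False
      then show ?thesis using D_nonempty[OF that] by (simp add: D'_def)
    qed
    show "jonsson_ops n (D' w) (\<lambda>k. d k w)" if "w \<in> V" for w
      using chain[OF that] sub jonsson_ops_subset by blast
  qed (use arc' compat' in blast)+
  moreover have "D' u = Z" using D'_eq walk.refl[OF u] by blast
  then have "\<exists>w\<in>V. D' w \<noteq> D w" using u unfolding node_def by blast
  ultimately show ?thesis using sub by blast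
qed

text \<open>Unary operations available simultaneously at all variables; global solutions may be
  used as constants, but only in the middle position.\<close>

inductive_set unary :: "('v \<Rightarrow> 'a \<Rightarrow> 'a) set" where
  id: "(\<lambda>v x. x) \<in> unary"
| const: "\<phi> \<in> unary \<Longrightarrow> \<psi> \<in> unary \<Longrightarrow> p \<in> S \<Longrightarrow> k \<le> n \<Longrightarrow> (\<lambda>v x. d k v (\<phi> v x) (p v) (\<psi> v x)) \<in> unary"
| op: "\<phi> \<in> unary \<Longrightarrow> \<chi> \<in> unary \<Longrightarrow> \<psi> \<in> unary \<Longrightarrow> k \<le> n \<Longrightarrow>
    (\<lambda>v x. d k v (\<phi> v x) (\<chi> v x) (\<psi> v x)) \<in> unary"

lemma unary_loc: "\<phi> \<in> unary \<Longrightarrow> C \<in> CC \<Longrightarrow> r \<in> loc C \<Longrightarrow> \<exists>s\<in>loc C. \<forall>w\<in>C. s w = \<phi> w (r w)"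
proof (induction rule: unary.induct)
  case id
  then show ?case by blast
next
  case (const \<phi> \<psi> p k)
  then obtain s t where "s \<in> loc C" "\<forall>w\<in>C. s w = \<phi> w (r w)" "t \<in> loc C" "\<forall>w\<in>C. t w = \<psi> w (r w)" by blast
  then show ?case using loc_op[OF const.prems(1) const.hyps(4) _ _ const.hyps(3), of s t] by simp
next
  case (op \<phi> \<chi> \<psi> k)
  then obtain s t c where "s \<in> loc C" "\<forall>w\<in>C. s w = \<phi> w (r w)" "t \<in> loc C" "\<forall>w\<in>C. t w = \<psi> w (r w)"
    "c \<in> loc C" "\<forall>w\<in>C. c w = \<chi> w (r w)" by blast
  then show ?case using loc_op[OF op.prems(1) op.hyps(4) _ _ locD(1), of s t c] by simp
qed

lemma unary_D: "\<phi> \<in> unary \<Longrightarrow> v \<in> V \<Longrightarrow> x \<in> D v \<Longrightarrow> \<phi> v x \<in> D v"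
proof -
  assume *: "\<phi> \<in> unary" "v \<in> V" "x \<in> D v"
  obtain C where C: "C \<in> CC" "v \<in> C" using scopes *(2) by blast
  obtain r where r: "r \<in> loc C" "r v = x" using loc_arc[OF C *(3)] by blast
  obtain s where "s \<in> loc C" "\<forall>w\<in>C. s w = \<phi> w (r w)" using unary_loc[OF *(1) C(1) r(1)] by blast
  then show ?thesis using C(2) r(2) locD(2) by force
qed

lemma unary_comp: "\<phi> \<in> unary \<Longrightarrow> \<gamma> \<in> unary \<Longrightarrow> (\<lambda>v x. \<phi> v (\<gamma> v x)) \<in> unary"
  by (induction rule: unary.induct) (auto intro: unary.intros)

lemma unary_pow: "\<gamma> \<in> unary \<Longrightarrow> (\<lambda>v x. (\<gamma> v ^^ i) x) \<in> unary"
proof (induction i)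
  case (Suc i)
  then show ?case using unary_comp[of \<gamma> "\<lambda>v x. (\<gamma> v ^^ i) x"] by simp
qed (use unary.id in \<open>simp add: id_def\<close>)

text \<open>The powers of \<open>\<gamma>\<close> are injective on a finite domain, so iterating
  \<open>\<gamma>\<close> on \<open>x\<close> gives an \<open>E\<close>-cycle. As \<open>E\<close>
  absorbs the identity relation, the loop lemma yields \<open>\<phi>\<close> with
  \<open>\<phi> v x = \<phi> v (\<gamma> v x)\<close>, and \<open>\<phi>\<close> is
  injective.\<close>

lemma unary_trivial:
  assumes inj: "\<And>\<phi> v. \<phi> \<in> unary \<Longrightarrow> v \<in> V \<Longrightarrow> inj_on (\<phi> v) (D v)"
    and \<gamma>: "\<gamma> \<in> unary" and v: "v \<in> V" and x: "x \<in> D v"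
  shows "\<gamma> v x = x"
proof -
  define E where "E = {(\<phi> v x, \<phi> v (\<gamma> v x)) |\<phi>. \<phi> \<in> unary}"
  have step: "((\<gamma> v ^^ i) x, (\<gamma> v ^^ Suc i) x) \<in> E" for i
    using unary_pow[OF \<gamma>, of i] unfolding E_def by (force simp: funpow_swap1)
  have walk: "(x, (\<gamma> v ^^ i) x) \<in> E ^^ i" for i
    by (induction i) (use step in auto)
  have "\<not> inj (\<lambda>i. (\<gamma> v ^^ i) x)"
  proof
    assume "inj (\<lambda>i. (\<gamma> v ^^ i) x)"
    moreover have "range (\<lambda>i. (\<gamma> v ^^ i) x) \<subseteq> D v" using unary_D[OF unary_pow[OF \<gamma>] v x] by blast
    ultimately show False using finite_D[OF v] finite_subset finite_imageD by blast
  qed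
  then obtain i j where ij: "i < j" "(\<gamma> v ^^ i) x = (\<gamma> v ^^ j) x" unfolding inj_def by (metis linorder_neqE_nat)
  then have "(\<gamma> v ^^ i) x = (\<gamma> v ^^ i) ((\<gamma> v ^^ (j - i)) x)"
    by (metis add_diff_inverse_nat comp_apply funpow_add less_imp_not_less)
  then have "(\<gamma> v ^^ (j - i)) x = x"
    using inj_onD[OF inj[OF unary_pow[OF \<gamma>] v]] x unary_D[OF unary_pow[OF \<gamma>] v x] by metis
  then have "(x, x) \<in> E\<^sup>+" using walk[of "j - i"] ij(1) by (metis trancl_power zero_less_diff)
  moreover have "E \<subseteq> D v \<times> D v"
    using unary_D[OF _ v] x unary_D[OF \<gamma> v x] unfolding E_def by blast
  moreover have "rel_absorbs n (\<lambda>k. d k v) (\<lambda>k. d k v) E (E \<union> Id_on (D v))"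
    unfolding rel_absorbs_def
  proof (intro allI impI)
    fix k a a' b b' c c'
    assume *: "k \<le> n" "(a, a') \<in> E" "(b, b') \<in> E \<union> Id_on (D v)" "(c, c') \<in> E"
    then obtain \<phi> \<psi> where \<phi>: "\<phi> \<in> unary" "a = \<phi> v x" "a' = \<phi> v (\<gamma> v x)"
      and \<psi>: "\<psi> \<in> unary" "c = \<psi> v x" "c' = \<psi> v (\<gamma> v x)" unfolding E_def by blast
    from *(3) show "(d k v a b c, d k v a' b' c') \<in> E"
    proof
      assume "(b, b') \<in> E"
      then obtain \<chi> where \<chi>: "\<chi> \<in> unary" "b = \<chi> v x" "b' = \<chi> v (\<gamma> v x)" unfolding E_def by blast
      let ?\<theta> = "\<lambda>w y. d k w (\<phi> w y) (\<chi> w y) (\<psi> w y)"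
      have "?\<theta> \<in> unary" by (rule unary.op[OF \<phi>(1) \<chi>(1) \<psi>(1) *(1)])
      then have "(?\<theta> v x, ?\<theta> v (\<gamma> v x)) \<in> E" unfolding E_def by (intro CollectI exI[of _ ?\<theta>]) simp
      then show ?thesis using \<phi> \<chi> \<psi> by simp
    next
      assume "(b, b') \<in> Id_on (D v)"
      \<comment> \<open>Equal middle arguments are covered by the constants, because each value in
        \<open>D v\<close> is taken by a global solution.\<close>
      then obtain p where p: "p \<in> S" "b = p v" "b' = p v" using D_global[OF v] by fastforce
      let ?\<theta> = "\<lambda>w y. d k w (\<phi> w y) (p w) (\<psi> w y)"
      have "?\<theta> \<in> unary" by (rule unary.const[OF \<phi>(1) \<psi>(1) p(1) *(1)])
      then have "(?\<theta> v x, ?\<theta> v (\<gamma> v x)) \<in> E" unfolding E_def by (intro CollectI exI[of _ ?\<theta>]) simp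
      then show ?thesis using \<phi> \<psi> p by simp
    qed
  qed
  moreover have "d k v a b c \<in> D v" if "k \<le> n" "a \<in> D v" "b \<in> D v" "c \<in> D v" for k a b c
    using op_in_D[OF v that(1,2,4)] D_global[OF v that(3)] by blast
  ultimately obtain c where "(c, c) \<in> E"
    using absorbed_cycle_has_loop[OF finite_D[OF v] chain[OF v], of E x] by blast
  then obtain \<phi> where "\<phi> \<in> unary" "\<phi> v x = \<phi> v (\<gamma> v x)" unfolding E_def by auto
  then have "x = \<gamma> v x" using inj_onD[OF inj[OF _ v] _ x unary_D[OF \<gamma> v x]] by blast
  then show ?thesis by simp
qed

text \<open>An idempotent power \<open>\<psi>\<close> of \<open>\<phi>\<close> maps the domains onto
  its images. Composing the operations with \<open>\<psi>\<close> keeps the identities, as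
  \<open>\<psi>\<close> fixes its image pointwise.\<close>

lemma shrink_by_retraction:
  assumes \<phi>: "\<phi> \<in> unary" and v: "v \<in> V" and noninj: "\<not> inj_on (\<phi> v) (D v)"
  shows "\<exists>D' d'. absorbing_instance n V S CC D' d' \<and> (\<forall>w\<in>V. D' w \<subseteq> D w) \<and> (\<exists>w\<in>V. D' w \<noteq> D w)"
proof -
  \<comment> \<open>Acting on the disjoint union of the domains gives one exponent \<open>K\<close>
    for all variables.\<close>
  define F where "F = (\<lambda>(w, x). (w, \<phi> w x))"
  have F_pow: "(F ^^ i) (w, x) = (w, (\<phi> w ^^ i) x)" for i w x
    by (induction i) (auto simp: F_def)
  have "finite (SIGMA w:V. D w)" using finite_V finite_D by blast
  moreover have "F z \<in> (SIGMA w:V. D w)" if "z \<in> (SIGMA w:V. D w)" for z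
    using that unary_D[OF \<phi>] by (auto simp: F_def)
  ultimately obtain K where K: "0 < K" "\<And>z. z \<in> (SIGMA w:V. D w) \<Longrightarrow> (F ^^ K) ((F ^^ K) z) = (F ^^ K) z"
    using finite_idempotent_power by metis
  define \<psi> where "\<psi> = (\<lambda>w x. (\<phi> w ^^ K) x)"
  have \<psi>: "\<psi> \<in> unary" unfolding \<psi>_def by (rule unary_pow[OF \<phi>])
  have idem: "\<psi> w (\<psi> w x) = \<psi> w x" if "w \<in> V" "x \<in> D w" for w x
    using K(2)[of "(w, x)"] that by (simp add: F_pow \<psi>_def)
  define D' where "D' w = \<psi> w ` D w" for w
  define d' where "d' k w x y z = \<psi> w (d k w x y z)" for k w x y z
  have sub: "D' w \<subseteq> D w" if "w \<in> V" for w using unary_D[OF \<psi> that] by (auto simp: D'_def)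
  have fixed: "\<psi> w x = x" if "w \<in> V" "x \<in> D' w" for w x using that idem by (auto simp: D'_def)
  have CV: "w \<in> V" if "C \<in> CC" "w \<in> C" for C w using that scopes by blast
  have "absorbing_instance n V S CC D' d'"
  proof
    show "finite V" "\<Union> CC = V" "{} \<notin> CC" using finite_V scopes by auto
    show "finite (D' w)" "D' w \<noteq> {}" if "w \<in> V" for w
      using finite_D[OF that] D_nonempty[OF that] by (auto simp: D'_def)
    show "\<exists>s\<in>S. s w = a \<and> (\<forall>x\<in>C. s x \<in> D' x)" if C: "C \<in> CC" "w \<in> C" and a: "a \<in> D' w" for C w a
    proof -
      obtain b where b: "b \<in> D w" "a = \<psi> w b" using a by (auto simp: D'_def)
      obtain r where r: "r \<in> loc C" "r w = b" using loc_arc[OF C b(1)] by blast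
      obtain s where s: "s \<in> loc C" "\<forall>x\<in>C. s x = \<psi> x (r x)" using unary_loc[OF \<psi> C(1) r(1)] by blast
      then have "s w = a" "\<forall>x\<in>C. s x \<in> D' x" using b r C(2) locD(2)[OF r(1)] by (auto simp: D'_def)
      then show ?thesis using s locD(1) by blast
    qed
    show "\<exists>s\<in>S. \<forall>w\<in>C. s w = d' k w (r w) (p w) (q w) \<and> s w \<in> D' w"
      if C: "C \<in> CC" "k \<le> n" and r: "r \<in> S" "\<forall>w\<in>C. r w \<in> D' w" and q: "q \<in> S" "\<forall>w\<in>C. q w \<in> D' w"
        and p: "p \<in> S" for C k r q p
    proof -
      have "r \<in> loc C" "q \<in> loc C" using r q sub CV[OF C(1)] by (auto simp: loc_def)
      then obtain t where t: "t \<in> loc C" "\<forall>w\<in>C. t w = d k w (r w) (p w) (q w)"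
        using loc_op[OF C _ _ p] by blast
      obtain s where s: "s \<in> loc C" "\<forall>w\<in>C. s w = \<psi> w (t w)" using unary_loc[OF \<psi> C(1) t(1)] by blast
      then have "\<forall>w\<in>C. s w = d' k w (r w) (p w) (q w) \<and> s w \<in> D' w"
        using t locD(2)[OF t(1)] by (auto simp: D'_def d'_def)
      then show ?thesis using s locD(1) by blast
    qed
    show "jonsson_ops n (D' w) (\<lambda>k. d' k w)" if w: "w \<in> V" for w
      using jonsson_ops_subset[OF chain[OF w] sub[OF w]] fixed[OF w]
      unfolding jonsson_ops_def d'_def by simp
  qed
  moreover have "D' v \<noteq> D v"
  proof
    assume "D' v = D v"
    then have inj: "inj_on (\<psi> v) (D v)" using finite_D[OF v] unfolding D'_def by (simp add: eq_card_imp_inj_on)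
    have "\<psi> v x = (\<phi> v ^^ (K - 1)) (\<phi> v x)" for x
      using K(1) funpow_Suc_right[of "K - 1" "\<phi> v"] by (simp add: \<psi>_def)
    then have "\<psi> v x = \<psi> v y" if "\<phi> v x = \<phi> v y" for x y using that by simp
    then have "inj_on (\<phi> v) (D v)" using inj unfolding inj_on_def by blast
    then show False using noninj by blast
  qed
  ultimately show ?thesis using sub v by blast
qed

text \<open>If all unary operations are injective, they are trivial, so \<open>{a}\<close> is closed
  with any global value in the middle; it is proper because of \<open>b\<close>.\<close>

lemma shrink:
  assumes "v \<in> V" "a \<in> D v" "b \<in> D v" "a \<noteq> b"
  shows "\<exists>D' d'. absorbing_instance n V S CC D' d' \<and> (\<forall>w\<in>V. D' w \<subseteq> D w) \<and> (\<exists>w\<in>V. D' w \<noteq> D w)"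
proof (cases "\<exists>\<phi>\<in>unary. \<exists>w\<in>V. \<not> inj_on (\<phi> w) (D w)")
  case True
  then obtain \<phi> w where "\<phi> \<in> unary" "w \<in> V" "\<not> inj_on (\<phi> w) (D w)" by blast
  then show ?thesis by (rule shrink_by_retraction)
next
  case False
  have "d k v a (p v) a = a" if "k \<le> n" "p \<in> S" for k p
    using unary_trivial[of "\<lambda>v x. d k v x (p v) x"] unary.const[OF unary.id unary.id that(2,1)] False assms by blast
  moreover have "{a} \<subset> D v" using assms by auto
  ultimately have "node v {a}" using assms(1) unfolding node_def by simp
  from shrink_to_component[OF this] obtain D' where "absorbing_instance n V S CC D' d"
    "\<forall>w\<in>V. D' w \<subseteq> D w" "\<exists>w\<in>V. D' w \<noteq> D w" by (elim exE conjE)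
  then show ?thesis by (intro exI[of _ D'] exI[of _ d] conjI)
qed

end

text \<open>The total size of the domains drops until all are singletons; arc consistency then
  provides a member of \<open>S\<close> with the prescribed values on each scope.\<close>

theorem absorbing_instance_solution:
  assumes "absorbing_instance n V S CC D d"
  shows "\<exists>f. (\<forall>v\<in>V. f v \<in> D v) \<and> (\<forall>C\<in>CC. \<exists>s\<in>S. \<forall>w\<in>C. s w = f w)"
  using assms
proof (induction "\<Sum>v\<in>V. card (D v)" arbitrary: D d rule: less_induct)
  case less
  interpret absorbing_instance n V S CC D d by (rule less.prems)
  show ?case
  proof (cases "\<exists>v\<in>V. \<exists>a\<in>D v. \<exists>b\<in>D v. a \<noteq> b")
    case True
    then obtain v a b where "v \<in> V" "a \<in> D v" "b \<in> D v" "a \<noteq> b" by blast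
    from shrink[OF this] obtain D' d' where D': "absorbing_instance n V S CC D' d'"
      "\<And>w. w \<in> V \<Longrightarrow> D' w \<subseteq> D w" "\<exists>w\<in>V. D' w \<noteq> D w" by blast
    have "(\<Sum>v\<in>V. card (D' v)) < (\<Sum>v\<in>V. card (D v))"
    proof (rule sum_strict_mono_ex1)
      show "\<forall>v\<in>V. card (D' v) \<le> card (D v)" using D'(2) finite_D card_mono by blast
      show "\<exists>v\<in>V. card (D' v) < card (D v)" using D'(2,3) finite_D psubset_card_mono by (metis psubsetI)
    qed (rule finite_V)
    from less.hyps[OF this D'(1)] show ?thesis using D'(2) by blast
  next
    case False
    define f where "f v = (SOME a. a \<in> D v)" for v
    have f: "f v \<in> D v" if "v \<in> V" for v using D_nonempty[OF that] by (simp add: f_def some_in_eq)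
    have "\<exists>s\<in>S. \<forall>w\<in>C. s w = f w" if C: "C \<in> CC" for C
    proof -
      obtain v where "v \<in> C" using C scopes(2) by (metis ex_in_conv)
      then have "v \<in> V" using C scopes(1) by blast
      then obtain s where "s \<in> S" "\<forall>w\<in>C. s w \<in> D w"
        using arc_consistent[OF C \<open>v \<in> C\<close> f] by blast
      moreover have "w \<in> V" if "w \<in> C" for w using that C scopes(1) by blast
      ultimately show ?thesis using False f by blast
    qed
    then show ?thesis using f by blast
  qed
qed

subsection \<open>Combs\<close>

fun rel_between :: "(nat \<Rightarrow> 'a rel) \<Rightarrow> nat \<Rightarrow> nat \<Rightarrow> 'a rel" where
  "rel_between E s 0 = Id"
| "rel_between E s (Suc m) = rel_between E s m O E (s + m)"

lemma rel_between_add: "rel_between E s (i + j) = rel_between E s i O rel_between E (s + i) j"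
  by (induction j) (auto simp: O_assoc add.assoc)

text \<open>\<open>P t\<close> are the values reachable from \<open>P 0\<close> along \<open>E 0, \<dots>, E (t - 1)\<close> and \<open>G t\<close> those from
  which \<open>G l\<close> can be reached; replacing a single \<open>E t\<close> by \<open>E' t\<close> connects \<open>P 0\<close> with \<open>G l\<close>.\<close>

definition comb :: "nat \<Rightarrow> 'a set \<Rightarrow> (nat \<Rightarrow> 'a \<Rightarrow> 'a \<Rightarrow> 'a \<Rightarrow> 'a) \<Rightarrow> nat \<Rightarrow>
    (nat \<Rightarrow> 'a rel) \<Rightarrow> (nat \<Rightarrow> 'a rel) \<Rightarrow> (nat \<Rightarrow> 'a set) \<Rightarrow> (nat \<Rightarrow> 'a set) \<Rightarrow> bool" where
  "comb n A d l E E' P G \<longleftrightarrow>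
    (\<forall>t<l. E t \<subseteq> E' t \<and> E' t \<subseteq> A \<times> A \<and> rel_absorbs n d d (E t) (E' t) \<and>
      P (Suc t) = E t `` P t \<and> G t = (E t)\<inverse> `` G (Suc t) \<and> (\<exists>x\<in>P t. \<exists>y\<in>G (Suc t). (x, y) \<in> E' t)) \<and>
    (\<forall>t\<le>l. P t \<subseteq> A \<and> G t \<subseteq> A \<and> P t \<inter> G t = {})"

text \<open>The four equal composites make \<open>R\<close> idempotent, hence transitive, with
  \<open>F = R\<close> F\<open>and\<close>H = R\<inverse> \<open>H\<close>. Replacing
  \<open>E s1\<close> by \<open>E' s1\<close> joins some \<open>x \<in> F\<close> to some
  \<open>y' \<in> H\<close>; going back from \<open>x\<close> and on from \<open>y'\<close> one
  finds loops of \<open>R\<close> at \<open>a \<in> F\<close> and \<open>b \<in> H\<close>. As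
  \<open>R\<close> absorbs the modified composite, the Jonsson operations give an
  \<open>R\<close>-walk from \<open>a\<close> to \<open>b\<close>, so
  \<open>b \<in> F\<close>.\<close>

lemma comb_homogeneous_contradiction:
  assumes chain: "jonsson_ops n A d" and fin: "finite A" and comb: "comb n A d l E E' P G"
    and s: "s0 < s1" "s1 < s2" "s2 < s3" "s3 < l"
    and R: "rel_between E s0 (s1 - s0) = R" "rel_between E s1 (s2 - s1) = R" "rel_between E s2 (s3 - s2) = R"
      "rel_between E s0 (s2 - s0) = R"
    and F: "P s0 = F" "P s1 = F" and H: "G s1 = H" "G s2 = H" "G s3 = H"
  shows False
proof -
  have c: "E t \<subseteq> E' t" "E' t \<subseteq> A \<times> A" "rel_absorbs n d d (E t) (E' t)" "P (Suc t) = E t `` P t"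
    "G t = (E t)\<inverse> `` G (Suc t)" "\<exists>x\<in>P t. \<exists>y\<in>G (Suc t). (x, y) \<in> E' t" if "t < l" for t
    using comb that unfolding comb_def by blast+
  have "s1 \<le> l" using s by simp
  then have "P s1 \<subseteq> A \<and> G s1 \<subseteq> A \<and> P s1 \<inter> G s1 = {}" using comb unfolding comb_def by blast
  then have FA: "F \<subseteq> A" "H \<subseteq> A" "F \<inter> H = {}" using F(2) H(1) by simp_all
  have P_between: "P (t + m) = rel_between E t m `` P t" if "t + m \<le> l" for t m
    using that by (induction m) (auto simp: c(4))
  have G_between: "G t = (rel_between E t m)\<inverse> `` G (t + m)" if "t + m \<le> l" for t m
    using that by (induction m) (auto simp: c(5))
  have abs_between: "rel_absorbs n d d (rel_between E t m) (rel_between E t m)" if "t + m \<le> l" for t m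
    using that
  proof (induction m)
    case (Suc m)
    then show ?case using rel_absorbs_mono[OF c(3) c(1), of "t + m"]
      by (auto intro: rel_absorbs_comp)
  qed (auto simp: rel_absorbs_def)
  have RR: "R O R = R" using rel_between_add[of E s0 "s1 - s0" "s2 - s1"] s R by simp
  then have tr: "trans R" unfolding trans_def by blast
  have "F = R `` F" using P_between[of s0 "s1 - s0"] s R(1) F by simp
  have "H = R\<inverse> `` H" using G_between[of s2 "s3 - s2"] s R(3) H by simp
  obtain x y where xy: "x \<in> F" "y \<in> G (Suc s1)" "(x, y) \<in> E' s1" using c(6)[of s1] s F by auto
  obtain y' where y': "y' \<in> H" "(y, y') \<in> rel_between E (Suc s1) (s2 - Suc s1)"
    using G_between[of "Suc s1" "s2 - Suc s1"] xy(2) s H(2) by auto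
  obtain a where a: "a \<in> F" "(a, a) \<in> R\<^sup>+" "(a, x) \<in> R\<^sup>*"
    using recurrent_ancestor[of F x R] xy(1) \<open>F = R `` F\<close> FA(1) finite_subset[OF _ fin] by blast
  obtain b where b: "b \<in> H" "(b, b) \<in> (R\<inverse>)\<^sup>+" "(b, y') \<in> (R\<inverse>)\<^sup>*"
    using recurrent_ancestor[of H y' "R\<inverse>"] y'(1) \<open>H = R\<inverse> `` H\<close> FA(2) finite_subset[OF _ fin] by blast
  have aa: "(a, a) \<in> R" and ax: "(a, x) \<in> R"
    using a(2,3) tr by (auto simp: trancl_id dest: rtranclD)
  have "trans (R\<inverse>)" using tr by simp
  then have bb: "(b, b) \<in> R" and yb: "(y', b) \<in> R"
    using b(2,3) by (auto simp: trancl_id dest: rtranclD)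
  define Q where "Q = E s1 O rel_between E (Suc s1) (s2 - Suc s1)"
  define Q' where "Q' = E' s1 O rel_between E (Suc s1) (s2 - Suc s1)"
  have "Q = R"
  proof -
    have "rel_between E s1 (1 + (s2 - Suc s1)) = rel_between E s1 1 O rel_between E (s1 + 1) (s2 - Suc s1)"
      by (rule rel_between_add)
    moreover have "1 + (s2 - Suc s1) = s2 - s1" using s by simp
    ultimately show ?thesis using R(2) by (simp only: Q_def) simp
  qed
  moreover have "rel_absorbs n d d Q Q'" unfolding Q_def Q'_def
    using c(3)[of s1] abs_between[of "Suc s1" "s2 - Suc s1"] s by (intro rel_absorbs_comp) auto
  ultimately have absQ: "rel_absorbs n d d R Q'" by simp
  have absR: "rel_absorbs n d d R R" using abs_between[of s0 "s1 - s0"] s R(1) by simp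
  have abs: "rel_absorbs n d d R ((R O Q') O R)"
    using rel_absorbs_comp[OF rel_absorbs_comp[OF absR absQ] absR] by (simp add: RR)
  have "(a, b) \<in> (R O Q') O R"
    using ax xy(3) y'(2) yb unfolding Q'_def by blast
  then have "(d k a a b, d k a b b) \<in> R" if "k \<le> n" for k
    by (rule rel_absorbsD[OF abs that aa _ bb])
  then have "b \<in> F"
    using jonsson_ops_path[OF chain, of a b R F] a(1) b(1) FA \<open>F = R `` F\<close> by blast
  then show False using b(1) FA(3) by blast
qed

text \<open>Ramsey's theorem is applied to pairs of positions; the number of colours, and so
  \<open>N\<close>, depends on \<open>A\<close> only.\<close>

lemma no_long_comb:
  assumes fin: "finite A"
  shows "\<exists>N. \<forall>n d E E' P G. jonsson_ops n A d \<longrightarrow> \<not> comb n A d N E E' P G"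
proof -
  let ?Col = "Pow (A \<times> A) \<times> Pow A \<times> Pow A"
  have finC: "finite ?Col" using fin by simp
  then obtain h where h: "bij_betw h ?Col {..<card ?Col}"
    using ex_bij_betw_finite_nat by (metis lessThan_atLeast0)
  obtain N :: nat where N: "partn_lst {..<N} (replicate (card ?Col) 4) 2"
    using ramsey_full by blast
  have "\<not> comb n A d N E E' P G" if chain: "jonsson_ops n A d" for n d E E' P G
  proof
    assume comb: "comb n A d N E E' P G"
    \<comment> \<open>\<open>P\<close> is read at the smaller and \<open>G\<close> at the larger
      position, so four homogeneous positions have equal \<open>P\<close> at \<open>s0, s1\<close>
      and equal \<open>G\<close> at \<open>s1, s2, s3\<close>.\<close>
    define col where "col s t = (rel_between E s (t - s), P s, G t)" for s t
    have EA: "E t \<subseteq> A \<times> A" if "t < N" for t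
      using comb that unfolding comb_def by (meson subset_trans)
    have PG: "P t \<subseteq> A" "G t \<subseteq> A" if "t < N" for t
      using comb less_imp_le[OF that] unfolding comb_def by blast+
    have sub: "rel_between E s (Suc m) \<subseteq> A \<times> A" if "s + m < N" for s m
      using that
    proof (induction m)
      case 0
      then show ?case using EA[of s] by simp
    next
      case (Suc m)
      then have "rel_between E s (Suc m) \<subseteq> A \<times> A" "E (s + Suc m) \<subseteq> A \<times> A"
        using EA[of "s + Suc m"] by simp_all
      then show ?case by (subst rel_between.simps) blast
    qed
    have col: "col s t \<in> ?Col" if "s < t" "t < N" for s t
    proof -
      have "rel_between E s (t - s) \<subseteq> A \<times> A" using sub[of s "t - s - 1"] that by (simp add: Suc_diff_Suc)
      then show ?thesis using PG(1)[of s] PG(2)[of t] that by (simp add: col_def)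
    qed
    define f where "f e = h (col (Min e) (Max e))" for e
    have f: "f \<in> [{..<N}]\<^bsup>2\<^esup> \<rightarrow> {..<card ?Col}"
    proof
      fix e assume "e \<in> [{..<N}]\<^bsup>2\<^esup>"
      then obtain s t where "e = {s, t}" "s < t" "t < N" by (auto simp: ordered_nsets_2_eq)
      then have "col (Min e) (Max e) \<in> ?Col" using col by simp
      from bij_betw_apply[OF h this] show "f e \<in> {..<card ?Col}" by (simp only: f_def)
    qed
    from partn_lstE[OF N f] obtain i H where i: "i < card ?Col"
      "H \<in> [{..<N}]\<^bsup>(replicate (card ?Col) 4 ! i)\<^esup>" "f ` [H]\<^bsup>2\<^esup> \<subseteq> {i}"
      by (metis length_replicate)
    then have "H \<in> [{..<N}]\<^bsup>4\<^esup>" by simp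
    then obtain s0 s1 s2 s3 where H: "H = {s0, s1, s2, s3}" and s: "s0 < s1" "s1 < s2" "s2 < s3" "s3 < N"
      by (auto simp: ordered_nsets_4_eq)
    have same: "h (col s t) = i" if "s \<in> H" "t \<in> H" "s < t" for s t
    proof -
      have "{s, t} \<in> [H]\<^bsup>2\<^esup>" using that by simp
      then have "f {s, t} = i" using i(3) by blast
      then show ?thesis using that(3) by (simp add: f_def)
    qed
    have "col s t = col s0 s1" if "s \<in> H" "t \<in> H" "s < t" for s t
    proof -
      have "col s t \<in> ?Col" "col s0 s1 \<in> ?Col" using col that s H by auto
      moreover have "h (col s t) = h (col s0 s1)" using same that s H by simp
      ultimately show ?thesis using h unfolding bij_betw_def by (meson inj_onD)
    qed
    from this[of s1 s2] this[of s2 s3] this[of s0 s2] this[of s0 s3] show False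
      using s unfolding H col_def prod.inject
      by (intro comb_homogeneous_contradiction[OF chain fin comb s, of "rel_between E s0 (s1 - s0)" "P s0" "G s1"])
        simp_all
  qed
  then show ?thesis by blast
qed

subsection \<open>Arc consistent domains from leaf constraints\<close>

lemma comb_trivial:
  assumes "P \<subseteq> A" "U \<subseteq> A" "P \<inter> U = {}"
  shows "\<exists>E E' Ps G. comb n A d 0 E E' Ps G \<and> Ps 0 = P \<and> G 0 = U"
  using assms by (intro exI[of _ "\<lambda>_. {}"] exI[of _ "\<lambda>_. P"] exI[of _ "\<lambda>_. U"]) (simp add: comb_def)

lemma comb_extend:
  assumes comb: "comb n A d l E E' Ps G" "Ps 0 = R `` P"
    and "R \<subseteq> R'" "R' \<subseteq> A \<times> A" "rel_absorbs n d d R R'" "P \<subseteq> A" "U \<subseteq> A" "P \<inter> U = {}"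
    and "U = R\<inverse> `` G 0" "\<exists>x\<in>P. \<exists>y\<in>G 0. (x, y) \<in> R'"
  shows "\<exists>E E' Ps G. comb n A d (Suc l) E E' Ps G \<and> Ps 0 = P \<and> G 0 = U"
proof (intro exI conjI)
  have c: "E t \<subseteq> E' t" "E' t \<subseteq> A \<times> A" "rel_absorbs n d d (E t) (E' t)" "Ps (Suc t) = E t `` Ps t"
    "G t = (E t)\<inverse> `` G (Suc t)" "\<exists>x\<in>Ps t. \<exists>y\<in>G (Suc t). (x, y) \<in> E' t" if "t < l" for t
    using comb(1) that unfolding comb_def by blast+
  have c': "Ps t \<subseteq> A" "G t \<subseteq> A" "Ps t \<inter> G t = {}" if "t \<le> l" for t
    using comb(1) that unfolding comb_def by blast+
  show "comb n A d (Suc l) (case_nat R E) (case_nat R' E') (case_nat P Ps) (case_nat U G)"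
    unfolding comb_def
  proof (intro conjI allI impI)
    fix t
    { assume "t < Suc l"
      then consider (0) "t = 0" | (Suc) i where "t = Suc i" "i < l" by (cases t) auto
      then show "case_nat R E t \<subseteq> case_nat R' E' t" "case_nat R' E' t \<subseteq> A \<times> A"
        "rel_absorbs n d d (case_nat R E t) (case_nat R' E' t)"
        "case_nat P Ps (Suc t) = case_nat R E t `` case_nat P Ps t"
        "case_nat U G t = (case_nat R E t)\<inverse> `` case_nat U G (Suc t)"
        "\<exists>x\<in>case_nat P Ps t. \<exists>y\<in>case_nat U G (Suc t). (x, y) \<in> case_nat R' E' t"
        by (cases; use c assms(2-) in \<open>simp only: nat.case\<close>)+ }
    { assume "t \<le> Suc l"
      then show "case_nat P Ps t \<subseteq> A" "case_nat U G t \<subseteq> A" "case_nat P Ps t \<inter> case_nat U G t = {}"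
        using c' assms(6-8) by (cases t; simp)+ }
  qed
qed simp_all

text \<open>For a step off which nothing essential branches: \<open>R\<close> is merged into the
  first relation, so the length stays the same.\<close>

lemma comb_precompose:
  assumes comb: "comb n A d (Suc l) E E' Ps G" "Ps 0 = R `` P"
    and R: "R \<subseteq> A \<times> A" "rel_absorbs n d d R R" and P: "P \<subseteq> A" "U \<subseteq> A" "P \<inter> U = {}" and U: "U = R\<inverse> `` G 0"
  shows "\<exists>E E' Ps G. comb n A d (Suc l) E E' Ps G \<and> Ps 0 = P \<and> G 0 = U"
proof (intro exI conjI)
  let ?E = "E(0 := R O E 0)" and ?E' = "E'(0 := R O E' 0)" and ?P = "Ps(0 := P)" and ?G = "G(0 := U)"
  have c: "E t \<subseteq> E' t" "E' t \<subseteq> A \<times> A" "rel_absorbs n d d (E t) (E' t)" "Ps (Suc t) = E t `` Ps t"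
    "G t = (E t)\<inverse> `` G (Suc t)" "\<exists>x\<in>Ps t. \<exists>y\<in>G (Suc t). (x, y) \<in> E' t" if "t < Suc l" for t
    using comb that unfolding comb_def by blast+
  show "comb n A d (Suc l) ?E ?E' ?P ?G"
    unfolding comb_def
  proof (intro conjI allI impI)
    fix t
    { assume t: "t < Suc l"
      show "?E t \<subseteq> ?E' t" using c(1)[OF t] by (cases t) auto
      show "?E' t \<subseteq> A \<times> A" using c(2)[OF t] R(1) by (cases t) auto
      show "rel_absorbs n d d (?E t) (?E' t)"
        using c(3)[OF t] rel_absorbs_comp[OF R(2)] by (cases t) auto
      show "?P (Suc t) = ?E t `` ?P t" using c(4)[OF t] comb(2) by (cases t) (auto simp: relcomp_Image)
      show "?G t = (?E t)\<inverse> `` ?G (Suc t)"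
        using c(5)[OF t] U by (cases t) (auto simp: converse_relcomp relcomp_Image)
      show "\<exists>x\<in>?P t. \<exists>y\<in>?G (Suc t). (x, y) \<in> ?E' t"
      proof (cases t)
        case 0
        obtain x y where "x \<in> Ps 0" "y \<in> G (Suc 0)" "(x, y) \<in> E' 0" using c(6)[of 0] by blast
        then show ?thesis using comb(2) 0 by (auto 4 4)
      next
        case (Suc i)
        then show ?thesis using c(6)[OF t] by simp
      qed }
    { assume "t \<le> Suc l"
      then have "Ps t \<subseteq> A \<and> G t \<subseteq> A \<and> Ps t \<inter> G t = {}" using comb(1) unfolding comb_def by blast
      then show "?P t \<subseteq> A" "?G t \<subseteq> A" "?P t \<inter> ?G t = {}" using P by (cases t; simp)+ }
  qed
qed simp_all

text \<open>\<open>Lf\<close> gives additional unary constraints that global solutions may violate;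
  as in \<open>absorbing_instance\<close>, they tolerate a global value in the middle.
  \<open>M\<close> bounds the branching of the trees below: scopes have at most \<open>M\<close>
  variables and intersections two branches.\<close>

locale leaf_instance =
  fixes n :: nat and A :: "'a set" and d :: "nat \<Rightarrow> 'a \<Rightarrow> 'a \<Rightarrow> 'a \<Rightarrow> 'a"
    and V :: "'v set" and S :: "('v \<Rightarrow> 'a) set" and CC :: "'v set set" and Lf :: "'v \<Rightarrow> 'a set" and M :: nat
  assumes finite_A: "finite A" and chain: "jonsson_ops n A d"
    and finite_V: "finite V" and scopes: "\<Union> CC = V" "{} \<notin> CC"
    and scope_card: "C \<in> CC \<Longrightarrow> card C \<le> M" and M: "2 \<le> M"
    and S_A: "s \<in> S \<Longrightarrow> v \<in> V \<Longrightarrow> s v \<in> A"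
    and S_op: "k \<le> n \<Longrightarrow> r \<in> S \<Longrightarrow> p \<in> S \<Longrightarrow> q \<in> S \<Longrightarrow> \<exists>s\<in>S. \<forall>v\<in>V. s v = d k (r v) (p v) (q v)"
    and Lf_op: "v \<in> V \<Longrightarrow> k \<le> n \<Longrightarrow> x \<in> Lf v \<Longrightarrow> z \<in> Lf v \<Longrightarrow> p \<in> S \<Longrightarrow> d k x (p v) z \<in> Lf v"
begin

section \<open>Trees of constraints and the sets they derive\<close>

definition vals :: "'v \<Rightarrow> 'a set" where
  "vals v = {s v |s. s \<in> S}"

text \<open>\<open>der m u U\<close>: a tree of constraints with \<open>m\<close> leaves, each restricting a variable \<open>v\<close>
  to \<open>Lf v\<close>, restricts its root variable \<open>u\<close> to \<open>U\<close>.\<close>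

inductive der :: "nat \<Rightarrow> 'v \<Rightarrow> 'a set \<Rightarrow> bool" where
  full: "u \<in> V \<Longrightarrow> der 0 u (vals u)"
| leaf: "u \<in> V \<Longrightarrow> der 1 u (vals u \<inter> Lf u)"
| inter: "der m u U \<Longrightarrow> der m' u U' \<Longrightarrow> der (m + m') u (U \<inter> U')"
| node: "C \<in> CC \<Longrightarrow> u \<in> V \<Longrightarrow> (\<And>w. w \<in> C \<Longrightarrow> der (m w) w (U w)) \<Longrightarrow>
    der (\<Sum>w\<in>C. m w) u {s u |s. s \<in> S \<and> (\<forall>w\<in>C. s w \<in> U w)}"

lemma scope_V: "C \<in> CC \<Longrightarrow> w \<in> C \<Longrightarrow> w \<in> V"
  using scopes by blast

lemma finite_scope: "C \<in> CC \<Longrightarrow> finite C"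
  using finite_subset[OF _ finite_V] scopes by blast

lemma vals_A: "v \<in> V \<Longrightarrow> vals v \<subseteq> A"
  using S_A by (auto simp: vals_def)

lemma der_V: "der m u U \<Longrightarrow> u \<in> V"
  by (induction rule: der.induct) auto

lemma der_vals: "der m u U \<Longrightarrow> U \<subseteq> vals u"
  by (induction rule: der.induct) (auto simp: vals_def)

lemma vals_op:
  assumes "v \<in> V" "k \<le> n" "x \<in> vals v" "z \<in> vals v" "p \<in> S"
  shows "d k x (p v) z \<in> vals v"
proof -
  obtain r q where r: "r \<in> S" "x = r v" and q: "q \<in> S" "z = q v" using assms by (auto simp: vals_def)
  obtain s where "s \<in> S" "\<forall>v\<in>V. s v = d k (r v) (p v) (q v)"
    using S_op[OF assms(2) r(1) assms(5) q(1)] by blast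
  then show ?thesis using r q assms(1) unfolding vals_def by (metis (mono_tags, lifting) mem_Collect_eq)
qed

lemma der_op: "der m u U \<Longrightarrow> k \<le> n \<Longrightarrow> x \<in> U \<Longrightarrow> z \<in> U \<Longrightarrow> p \<in> S \<Longrightarrow> d k x (p u) z \<in> U"
proof (induction arbitrary: x z rule: der.induct)
  case (full u)
  then show ?case by (auto intro: vals_op)
next
  case (leaf u)
  then show ?case using Lf_op by (auto intro: vals_op)
next
  case (inter m u U m' U')
  then show ?case by blast
next
  case (node C u m U)
  from node.prems(2) obtain r where r: "r \<in> S" "\<forall>w\<in>C. r w \<in> U w" "x = r u" by blast
  from node.prems(3) obtain q where q: "q \<in> S" "\<forall>w\<in>C. q w \<in> U w" "z = q u" by blast
  obtain s where s: "s \<in> S" "\<forall>v\<in>V. s v = d k (r v) (p v) (q v)"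
    using S_op[OF node.prems(1) r(1) node.prems(4) q(1)] by blast
  have "s w \<in> U w" if "w \<in> C" for w
    using node.IH[OF that node.prems(1) _ _ node.prems(4)] r(2) q(2) s(2) that scope_V[OF node.hyps(1) that] by simp
  moreover have "d k x (p u) z = s u" using s(2) node.hyps(2) r(3) q(3) by simp
  ultimately show ?case using s(1) by blast
qed

lemma der_zero: "der m u U \<Longrightarrow> m = 0 \<Longrightarrow> U = vals u"
proof (induction rule: der.induct)
  case (node C u m U)
  then have "U w = vals w" if "w \<in> C" for w using that finite_scope by simp
  then show ?case by (auto simp: vals_def)
qed auto

text \<open>\<open>W\<close> is the set of variables at the leaves of the tree. Hence a tree
  deriving the empty set cannot have few leaves if few leaf constraints are always satisfiable
  together.\<close>

lemma der_support:
  "der m u U \<Longrightarrow> \<exists>W\<subseteq>V. card W \<le> m \<and> (\<forall>s\<in>S. (\<forall>w\<in>W. s w \<in> Lf w) \<longrightarrow> s u \<in> U)"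
proof (induction rule: der.induct)
  case (full u)
  then show ?case by (intro exI[of _ "{}"]) (auto simp: vals_def)
next
  case (leaf u)
  then show ?case by (intro exI[of _ "{u}"]) (auto simp: vals_def)
next
  case (inter m u U m' U')
  then obtain W W' where "W \<subseteq> V" "card W \<le> m" "\<forall>s\<in>S. (\<forall>w\<in>W. s w \<in> Lf w) \<longrightarrow> s u \<in> U"
    "W' \<subseteq> V" "card W' \<le> m'" "\<forall>s\<in>S. (\<forall>w\<in>W'. s w \<in> Lf w) \<longrightarrow> s u \<in> U'" by blast
  then show ?case using card_Un_le[of W W'] by (intro exI[of _ "W \<union> W'"]) auto
next
  case (node C u m U)
  then have "\<forall>w\<in>C. \<exists>W\<subseteq>V. card W \<le> m w \<and> (\<forall>s\<in>S. (\<forall>v\<in>W. s v \<in> Lf v) \<longrightarrow> s w \<in> U w)" by blast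
  then obtain W where W: "\<And>w. w \<in> C \<Longrightarrow> W w \<subseteq> V \<and> card (W w) \<le> m w \<and>
    (\<forall>s\<in>S. (\<forall>v\<in>W w. s v \<in> Lf v) \<longrightarrow> s w \<in> U w)" by metis
  have "card (\<Union>w\<in>C. W w) \<le> (\<Sum>w\<in>C. card (W w))" using card_UN_le[OF finite_scope[OF node.hyps(1)]] .
  also have "\<dots> \<le> (\<Sum>w\<in>C. m w)" using W by (intro sum_mono) blast
  finally have "card (\<Union>w\<in>C. W w) \<le> (\<Sum>w\<in>C. m w)" .
  moreover have "(\<Union>w\<in>C. W w) \<subseteq> V" using W by blast
  moreover have "s u \<in> {s u |s. s \<in> S \<and> (\<forall>w\<in>C. s w \<in> U w)}"
    if s: "s \<in> S" "\<forall>v\<in>(\<Union>w\<in>C. W w). s v \<in> Lf v" for s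
  proof -
    have "s w \<in> U w" if "w \<in> C" for w using W[OF that] s that by blast
    then show ?thesis using s(1) by blast
  qed
  ultimately show ?case by (intro exI[of _ "\<Union>w\<in>C. W w"] conjI ballI impI)
qed

section \<open>Combs in critical trees\<close>

text \<open>The path descends into the branch \<open>U\<close>: the edge \<open>Id_on U'\<close>
  respects the other branch, and \<open>Id_on (vals u)\<close> forgets it. That the latter joins
  \<open>P\<close> to \<open>U\<close> is criticality for the smaller tree of \<open>U\<close>. The
  induction hypothesis is an assumption so that both orders of the branches are covered.\<close>

lemma comb_of_critical_inter:
  assumes der: "der m u U" "der m' u U'" and IH: "\<And>P l. P \<subseteq> A \<Longrightarrow> P \<inter> U = {} \<Longrightarrow>
      (\<And>m1 U1. m1 < m \<Longrightarrow> der m1 u U1 \<Longrightarrow> P \<inter> U1 \<noteq> {}) \<Longrightarrow> M ^ l < m \<Longrightarrow>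
      \<exists>E E' Ps G. comb n A d l E E' Ps G \<and> Ps 0 = P \<and> G 0 = U"
    and P: "P \<subseteq> A" "P \<inter> (U \<inter> U') = {}"
    and crit: "\<And>m1 U1. m1 < m + m' \<Longrightarrow> der m1 u U1 \<Longrightarrow> P \<inter> U1 \<noteq> {}"
    and big: "M ^ l < m" "M ^ Suc l < m + m'"
  shows "\<exists>E E' Ps G. comb n A d (Suc l) E E' Ps G \<and> Ps 0 = P \<and> G 0 = U \<inter> U'"
proof (cases "m' = 0")
  case True
  then have "U \<inter> U' = U" using der_zero[OF der(2)] der_vals[OF der(1)] by blast
  then show ?thesis using IH[of P "Suc l"] P crit big(2) True by simp
next
  case False
  have sub: "U \<subseteq> A" "U' \<subseteq> A" "vals u \<subseteq> A" using der_vals der vals_A der_V by (meson subset_trans)+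
  have "\<exists>E E' Ps G. comb n A d l E E' Ps G \<and> Ps 0 = P \<inter> U' \<and> G 0 = U"
  proof (rule IH)
    fix m1 U1 assume "m1 < m" "der m1 u U1"
    then show "P \<inter> U' \<inter> U1 \<noteq> {}" using crit[OF _ der.inter[OF _ der(2)], of m1 U1] by auto
  qed (use P big in auto)
  then obtain E E' Ps G where c: "comb n A d l E E' Ps G" "Ps 0 = P \<inter> U'" "G 0 = U" by blast
  show ?thesis
  proof (rule comb_extend[OF c(1), of "Id_on U'" P "Id_on (vals u)"])
    show "rel_absorbs n d d (Id_on U') (Id_on (vals u))"
      using der_op[OF der(2)] unfolding rel_absorbs_def by (auto simp: vals_def)
    have "P \<inter> U \<noteq> {}" using crit[OF _ der(1)] False by simp
    then show "\<exists>x\<in>P. \<exists>y\<in>G 0. (x, y) \<in> Id_on (vals u)" using der_vals[OF der(1)] c(3) by auto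
  qed (use c P sub der_vals[OF der(2)] in auto)
qed

text \<open>The path always descends into a child with more than the \<open>M\<close>-th part of the
  leaves. The relation of a step keeps the constraints branching off, its enlargement drops them;
  criticality shows that dropping them joins \<open>P\<close> to the child's set. A step off which
  no leaf branches does not use up length.\<close>

lemma comb_of_critical:
  assumes "der m u U" "P \<subseteq> A" "P \<inter> U = {}" "\<And>m' U'. m' < m \<Longrightarrow> der m' u U' \<Longrightarrow> P \<inter> U' \<noteq> {}" "M ^ l < m"
  shows "\<exists>E E' Ps G. comb n A d l E E' Ps G \<and> Ps 0 = P \<and> G 0 = U"
  using assms
proof (induction arbitrary: P l rule: der.induct)
  case (full u)
  then show ?case by simp
next
  case (leaf u)
  then show ?case using M by simp
next
  case (inter m u U m' U')
  show ?case
  proof (cases l)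
    case 0
    have "U \<inter> U' \<subseteq> A" using der_vals[OF inter.hyps(1)] vals_A[OF der_V[OF inter.hyps(1)]] by blast
    then show ?thesis using comb_trivial[OF inter.prems(1) _ inter.prems(2)] 0 by simp
  next
    case (Suc l')
    have "2 * M ^ l' < m + m'" using inter.prems(4) M Suc
      by (metis le_less_trans mult_le_mono1 power_Suc)
    then consider "M ^ l' < m" | "M ^ l' < m'" by linarith
    then show ?thesis
    proof cases
      case 1
      show ?thesis unfolding Suc
        using inter.prems Suc 1
        by (intro comb_of_critical_inter[OF inter.hyps(1,2) inter.IH(1)]) auto
    next
      case 2
      have "\<exists>E E' Ps G. comb n A d (Suc l') E E' Ps G \<and> Ps 0 = P \<and> G 0 = U' \<inter> U"
        using inter.prems Suc 2
        by (intro comb_of_critical_inter[OF inter.hyps(2,1) inter.IH(2)]) (auto simp: add.commute Int_commute)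
      then show ?thesis unfolding Suc by (simp only: Int_commute)
    qed
  qed
next
  case (node C u m U)
  let ?X = "{s u |s. s \<in> S \<and> (\<forall>w\<in>C. s w \<in> U w)}"
  have X_A: "?X \<subseteq> A" using S_A node.hyps(2) by blast
  note finC = finite_scope[OF node.hyps(1)]
  show ?case
  proof (cases l)
    case 0
    then show ?thesis using comb_trivial[OF node.prems(1) X_A node.prems(2)] by simp
  next
    case (Suc l')
    have "\<exists>w\<in>C. M ^ l' < m w"
    proof (rule ccontr)
      assume "\<not> ?thesis"
      then have "(\<Sum>w\<in>C. m w) \<le> (\<Sum>w\<in>C. M ^ l')" by (intro sum_mono) (simp add: not_less)
      also have "\<dots> \<le> M ^ l" using scope_card[OF node.hyps(1)] Suc by simp
      finally show False using node.prems(4) by simp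
    qed
    then obtain w where w: "w \<in> C" "M ^ l' < m w" by blast
    then have wV: "w \<in> V" using scope_V[OF node.hyps(1)] by blast
    define R where "R = {(s u, s w) |s. s \<in> S \<and> (\<forall>v\<in>C - {w}. s v \<in> U v)}"
    define R' where "R' = {(s u, s w) |s. s \<in> S}"
    have split: "(\<Sum>v\<in>C. m v) = m w + (\<Sum>v\<in>C - {w}. m v)" using finC w(1) by (rule sum.remove)
    have RR': "R \<subseteq> R'" "R' \<subseteq> A \<times> A" using S_A node.hyps(2) wV by (auto simp: R_def R'_def)
    have abs: "rel_absorbs n d d R R'"
      unfolding rel_absorbs_def
    proof (intro allI impI)
      fix k x x' y y' z z' assume *: "k \<le> n" "(x, x') \<in> R" "(y, y') \<in> R'" "(z, z') \<in> R"
      from *(2) obtain r where r: "r \<in> S" "\<forall>v\<in>C - {w}. r v \<in> U v" "x = r u" "x' = r w" by (auto simp: R_def)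
      from *(3) obtain p where p: "p \<in> S" "y = p u" "y' = p w" by (auto simp: R'_def)
      from *(4) obtain q where q: "q \<in> S" "\<forall>v\<in>C - {w}. q v \<in> U v" "z = q u" "z' = q w" by (auto simp: R_def)
      obtain s where s: "s \<in> S" "\<forall>v\<in>V. s v = d k (r v) (p v) (q v)" using S_op[OF *(1) r(1) p(1) q(1)] by blast
      have "s v \<in> U v" if "v \<in> C - {w}" for v
        using der_op[OF node.hyps(3), of v k "r v" "q v" p] r(2) q(2) s(2) p(1) that *(1) scope_V[OF node.hyps(1)] by auto
      moreover have "d k x y z = s u" "d k x' y' z' = s w" using s(2) node.hyps(2) wV r p q by auto
      ultimately show "(d k x y z, d k x' y' z') \<in> R" using s(1) unfolding R_def by blast
    qed
    have X_eq: "?X = R\<inverse> `` U w" using w(1) by (auto simp: R_def)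
    then have disj: "R `` P \<inter> U w = {}" using node.prems(2) by blast
    have "R `` P \<subseteq> A" using RR' by blast
    have crit: "R `` P \<inter> U1 \<noteq> {}" if "m1 < m w" "der m1 w U1" for m1 U1
    proof -
      have "der (\<Sum>v\<in>C. (m(w := m1)) v) u {s u |s. s \<in> S \<and> (\<forall>v\<in>C. s v \<in> (U(w := U1)) v)}"
        using node.hyps that(2) by (intro der.node) auto
      moreover have "(\<Sum>v\<in>C. (m(w := m1)) v) < (\<Sum>v\<in>C. m v)"
        using that(1) split sum.remove[OF finC w(1), of "m(w := m1)"] by simp
      ultimately have "P \<inter> {s u |s. s \<in> S \<and> (\<forall>v\<in>C. s v \<in> (U(w := U1)) v)} \<noteq> {}"
        using node.prems(3) by blast
      then obtain s where s: "s \<in> S" "\<forall>v\<in>C. s v \<in> (U(w := U1)) v" "s u \<in> P" by blast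
      have "s v \<in> U v" if "v \<in> C - {w}" for v using s(2)[rule_format, of v] that by simp
      then have "(s u, s w) \<in> R" using s(1) unfolding R_def by blast
      moreover have "s w \<in> U1" using s(2)[rule_format, OF w(1)] by simp
      ultimately show ?thesis using s(3) by blast
    qed
    show ?thesis
    proof (cases "(\<Sum>v\<in>C - {w}. m v) = 0")
      case True
      then have "M ^ l < m w" using node.prems(4) split by simp
      then have "\<exists>E E' Ps G. comb n A d l E E' Ps G \<and> Ps 0 = R `` P \<and> G 0 = U w"
        using crit by (intro node.IH[OF w(1) \<open>R `` P \<subseteq> A\<close> disj])
      then obtain E E' Ps G where c: "comb n A d (Suc l') E E' Ps G" "Ps 0 = R `` P" "G 0 = U w"
        unfolding Suc by blast
      show ?thesis unfolding Suc
        by (rule comb_precompose[OF c(1,2) subset_trans[OF RR'] rel_absorbs_mono[OF abs RR'(1)]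
              node.prems(1) X_A node.prems(2)]) (simp only: X_eq c(3))
    next
      case False
      have "\<exists>E E' Ps G. comb n A d l' E E' Ps G \<and> Ps 0 = R `` P \<and> G 0 = U w"
        using crit w(2) by (intro node.IH[OF w(1) \<open>R `` P \<subseteq> A\<close> disj])
      then obtain E E' Ps G where c: "comb n A d l' E E' Ps G" "Ps 0 = R `` P" "G 0 = U w" by blast
      \<comment> \<open>Removing all leaves outside the child \<open>w\<close> gives a tree with
        fewer leaves, whose set therefore meets \<open>P\<close>.\<close>
      have "der (\<Sum>v\<in>C. if v = w then m w else 0) u
          {s u |s. s \<in> S \<and> (\<forall>v\<in>C. s v \<in> (if v = w then U w else vals v))}"
        using node.hyps der.full scope_V[OF node.hyps(1)] by (intro der.node) auto
      moreover have "(\<Sum>v\<in>C. if v = w then m w else 0) < (\<Sum>v\<in>C. m v)"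
      proof -
        have "(\<Sum>v\<in>C. if v = w then m w else 0) = m w" using finC w(1) by simp
        then show ?thesis using False split by linarith
      qed
      ultimately have "P \<inter> {s u |s. s \<in> S \<and> (\<forall>v\<in>C. s v \<in> (if v = w then U w else vals v))} \<noteq> {}"
        using node.prems(3) by blast
      then obtain s where s: "s \<in> S" "\<forall>v\<in>C. s v \<in> (if v = w then U w else vals v)" "s u \<in> P" by blast
      then have "s w \<in> U w" using s(2)[rule_format, OF w(1)] by simp
      with s have "\<exists>x\<in>P. \<exists>y\<in>G 0. (x, y) \<in> R'" using c(3) by (auto simp: R'_def)
      then show ?thesis unfolding Suc
        by (intro comb_extend[OF c(1,2) RR' abs node.prems(1) X_A node.prems(2)]) (simp only: X_eq c(3))
    qed
  qed
qed

section \<open>Nonempty arc consistent domains\<close>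

text \<open>A refuting tree with the fewest leaves has more than \<open>M ^ N\<close> of them by
  \<open>sat\<close>, and is critical for the full set \<open>vals u0\<close>, so it would contain a
  comb of length \<open>N\<close>.\<close>

lemma der_nonempty:
  assumes no_comb: "\<And>E E' P G. \<not> comb n A d N E E' P G"
    and sat: "\<And>W. W \<subseteq> V \<Longrightarrow> card W \<le> M ^ N \<Longrightarrow> \<exists>s\<in>S. \<forall>w\<in>W. s w \<in> Lf w"
    and der: "der m u U"
  shows "U \<noteq> {}"
proof
  assume "U = {}"
  then have ex: "\<exists>m u. der m u {}" using der by blast
  define m0 where "m0 = (LEAST m. \<exists>u. der m u {})"
  obtain u0 where u0: "der m0 u0 {}" using LeastI_ex[OF ex] unfolding m0_def by blast
  have least: "\<not> der m' v {}" if "m' < m0" for m' v using not_less_Least[OF that[unfolded m0_def]] by blast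
  show False
  proof (cases "m0 \<le> M ^ N")
    case True
    obtain W where "W \<subseteq> V" "card W \<le> m0" "\<forall>s\<in>S. (\<forall>w\<in>W. s w \<in> Lf w) \<longrightarrow> s u0 \<in> {}"
      using der_support[OF u0] by blast
    then show ?thesis using sat[of W] True by auto
  next
    case False
    have "\<exists>E E' Ps G. comb n A d N E E' Ps G \<and> Ps 0 = vals u0 \<and> G 0 = {}"
    proof (rule comb_of_critical[OF u0])
      show "vals u0 \<subseteq> A" using vals_A der_V[OF u0] by blast
      show "vals u0 \<inter> U' \<noteq> {}" if "m' < m0" "der m' u0 U'" for m' U'
        using least[OF that(1)] that(2) der_vals[OF that(2)] by (metis inf.absorb_iff2)
    qed (use False in auto)
    then show False using no_comb by blast
  qed
qed

definition core :: "'v \<Rightarrow> 'a set" where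
  "core v = \<Inter> {U. \<exists>m. der m v U}"

text \<open>Derived sets are finite and closed under intersection, so one of least size lies in all
  others.\<close>

lemma der_core:
  assumes v: "v \<in> V"
  shows "\<exists>m. der m v (core v)"
proof -
  have fin: "finite U" if "der m v U" for m U
    using der_vals[OF that] vals_A[OF v] finite_A by (meson finite_subset)
  obtain U m where U: "der m v U" "\<And>U' m'. der m' v U' \<Longrightarrow> card U \<le> card U'"
    using ex_has_least_nat[of "\<lambda>U. \<exists>m. der m v U" "vals v" card] der.full[OF v] by blast
  have "U \<subseteq> U'" if "der m' v U'" for m' U'
  proof -
    have "card U \<le> card (U \<inter> U')" using U(2)[OF der.inter[OF U(1) that]] .
    then show ?thesis using card_seteq[of U "U \<inter> U'"] fin[OF U(1)] by blast
  qed
  then have "core v = U" using U(1) by (auto simp: core_def)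
  then show ?thesis using U(1) by blast
qed

text \<open>Arc consistency holds because the cores on a scope derive a further set at
  \<open>v\<close>, which contains \<open>core v\<close> by definition.\<close>

theorem core_absorbing_instance:
  assumes no_comb: "\<And>E E' P G. \<not> comb n A d N E E' P G"
    and sat: "\<And>W. W \<subseteq> V \<Longrightarrow> card W \<le> M ^ N \<Longrightarrow> \<exists>s\<in>S. \<forall>w\<in>W. s w \<in> Lf w"
  shows "absorbing_instance n V S CC core (\<lambda>k v. d k)" and "v \<in> V \<Longrightarrow> core v \<subseteq> Lf v"
proof -
  have core_A: "core v \<subseteq> A" if v: "v \<in> V" for v using der_core[OF v] der_vals vals_A[OF v] by blast
  show "absorbing_instance n V S CC core (\<lambda>k v. d k)"
  proof
    show "finite V" "\<Union> CC = V" "{} \<notin> CC" using finite_V scopes by auto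
    show "finite (core v)" "core v \<noteq> {}" if v: "v \<in> V" for v
      using core_A[OF v] finite_A finite_subset der_core[OF v] der_nonempty[OF no_comb sat] by blast+
    show "jonsson_ops n (core v) d" if v: "v \<in> V" for v
      using jonsson_ops_subset[OF chain core_A[OF v]] .
    show "\<exists>s\<in>S. s v = a \<and> (\<forall>w\<in>C. s w \<in> core w)" if C: "C \<in> CC" "v \<in> C" and a: "a \<in> core v" for C v a
    proof -
      have "\<forall>w\<in>C. \<exists>m. der m w (core w)" using der_core scope_V[OF C(1)] by blast
      then obtain m where "\<And>w. w \<in> C \<Longrightarrow> der (m w) w (core w)" by metis
      from der.node[OF C(1) scope_V[OF C] this]
      have "core v \<subseteq> {s v |s. s \<in> S \<and> (\<forall>w\<in>C. s w \<in> core w)}" unfolding core_def[of v] by blast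
      then show ?thesis using a by blast
    qed
    show "\<exists>s\<in>S. \<forall>w\<in>C. s w = d k (r w) (p w) (q w) \<and> s w \<in> core w"
      if C: "C \<in> CC" "k \<le> n" and r: "r \<in> S" "\<forall>w\<in>C. r w \<in> core w" and q: "q \<in> S" "\<forall>w\<in>C. q w \<in> core w"
        and p: "p \<in> S" for C k r q p
    proof -
      obtain s where s: "s \<in> S" "\<forall>v\<in>V. s v = d k (r v) (p v) (q v)" using S_op[OF C(2) r(1) p q(1)] by blast
      have "s w = d k (r w) (p w) (q w) \<and> s w \<in> core w" if w: "w \<in> C" for w
      proof -
        obtain m where "der m w (core w)" using der_core[OF scope_V[OF C(1) w]] by blast
        from der_op[OF this C(2) _ _ p] show ?thesis using r(2) q(2) w s(2) scope_V[OF C(1) w] by simp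
      qed
      then show ?thesis using s(1) by blast
    qed
  qed
  show "core v \<subseteq> Lf v" if "v \<in> V"
    using der.leaf[OF that] unfolding core_def by blast
qed

end

subsection \<open>Polymorphisms\<close>

definition column :: "'a list list \<Rightarrow> nat \<Rightarrow> 'a list" where
  "column rs j = map (\<lambda>r. r ! j) rs"

lemma column_tuples:
  assumes "R \<subseteq> tuples A k" "rs \<in> tuples R n" "j < k"
  shows "column rs j \<in> tuples A n"
proof -
  have "r ! j \<in> A" if "r \<in> set rs" for r
  proof -
    have "set r \<subseteq> A" "length r = k" using that assms by auto
    then show ?thesis using assms(3) nth_mem by blast
  qed
  then show ?thesis using assms(2) by (auto simp: column_def)
qed

lemma polymorphisms_iff:
  "f \<in> polymorphisms A \<Gamma> n \<longleftrightarrow> f \<in> tuples A n \<rightarrow>\<^sub>E A \<and>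
    (\<forall>k R rs. (k, R) \<in> \<Gamma> \<longrightarrow> rs \<in> tuples R n \<longrightarrow> map (\<lambda>j. f (column rs j)) [0..<k] \<in> R)"
  unfolding polymorphisms_def column_def by auto

lemma polymorphism_values: "f \<in> polymorphisms A \<Gamma> n \<Longrightarrow> xs \<in> tuples A n \<Longrightarrow> f xs \<in> A"
  unfolding polymorphisms_iff using PiE_mem by blast

lemma polymorphism_projection:
  assumes "\<forall>(k, R) \<in> \<Gamma>. R \<subseteq> tuples A k" "i < n"
  shows "(\<lambda>xs \<in> tuples A n. xs ! i) \<in> polymorphisms A \<Gamma> n"
  unfolding polymorphisms_iff
proof (intro conjI allI impI)
  show "(\<lambda>xs \<in> tuples A n. xs ! i) \<in> tuples A n \<rightarrow>\<^sub>E A"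
    using assms(2) by (auto intro: nth_mem subsetD)
  fix k R rs assume *: "(k, R) \<in> \<Gamma>" "rs \<in> tuples R n"
  then have R: "R \<subseteq> tuples A k" using assms(1) by blast
  have in_R: "rs ! i \<in> R" using *(2) assms(2) by auto
  have "map (\<lambda>j. (\<lambda>xs \<in> tuples A n. xs ! i) (column rs j)) [0..<k] = map (\<lambda>j. rs ! i ! j) [0..<k]"
  proof (rule map_cong[OF HOL.refl])
    fix j assume "j \<in> set [0..<k]"
    then have "column rs j \<in> tuples A n" using column_tuples[OF R *(2)] by simp
    then show "(\<lambda>xs \<in> tuples A n. xs ! i) (column rs j) = rs ! i ! j"
      using *(2) assms(2) by (simp add: column_def)
  qed
  also have "\<dots> = rs ! i"
  proof -
    have "length (rs ! i) = k" using in_R R by blast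
    then show ?thesis using map_nth[of "rs ! i"] by simp
  qed
  finally show "map (\<lambda>j. (\<lambda>xs \<in> tuples A n. xs ! i) (column rs j)) [0..<k] \<in> R" using in_R by simp
qed

lemma polymorphism_comp:
  assumes \<Gamma>: "\<forall>(k, R) \<in> \<Gamma>. R \<subseteq> tuples A k" and f: "f \<in> polymorphisms A \<Gamma> m"
    and gs: "set gs \<subseteq> polymorphisms A \<Gamma> n" "length gs = m"
  shows "(\<lambda>xs \<in> tuples A n. f (map (\<lambda>g. g xs) gs)) \<in> polymorphisms A \<Gamma> n"
  unfolding polymorphisms_iff
proof (intro conjI allI impI)
  have g_A: "g xs \<in> A" if "g \<in> set gs" "xs \<in> tuples A n" for g xs
    using gs(1) that polymorphism_values by blast
  then have "map (\<lambda>g. g xs) gs \<in> tuples A m" if "xs \<in> tuples A n" for xs using that gs(2) by auto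
  then show "(\<lambda>xs \<in> tuples A n. f (map (\<lambda>g. g xs) gs)) \<in> tuples A n \<rightarrow>\<^sub>E A"
    using polymorphism_values[OF f] by (intro restrict_PiE_iff[THEN iffD2] ballI) simp
  fix k R rs assume *: "(k, R) \<in> \<Gamma>" "rs \<in> tuples R n"
  then have R: "R \<subseteq> tuples A k" using \<Gamma> by blast
  define qs where "qs = map (\<lambda>g. map (\<lambda>j. g (column rs j)) [0..<k]) gs"
  have "map (\<lambda>j. g (column rs j)) [0..<k] \<in> R" if "g \<in> set gs" for g
  proof -
    have "g \<in> polymorphisms A \<Gamma> n" using gs(1) that by blast
    then show ?thesis using * unfolding polymorphisms_iff by blast
  qed
  then have "qs \<in> tuples R m" using gs(2) by (auto simp: qs_def)
  then have "map (\<lambda>j. f (column qs j)) [0..<k] \<in> R" using f *(1) unfolding polymorphisms_iff by blast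
  moreover have "map (\<lambda>j. (\<lambda>xs \<in> tuples A n. f (map (\<lambda>g. g xs) gs)) (column rs j)) [0..<k] =
      map (\<lambda>j. f (column qs j)) [0..<k]"
  proof (rule map_cong[OF HOL.refl])
    fix j assume j: "j \<in> set [0..<k]"
    then have "column rs j \<in> tuples A n" using column_tuples[OF R *(2)] by simp
    moreover have "column qs j = map (\<lambda>g. g (column rs j)) gs" using j by (simp add: qs_def column_def comp_def)
    ultimately show "(\<lambda>xs \<in> tuples A n. f (map (\<lambda>g. g xs) gs)) (column rs j) = f (column qs j)" by simp
  qed
  ultimately show "map (\<lambda>j. (\<lambda>xs \<in> tuples A n. f (map (\<lambda>g. g xs) gs)) (column rs j)) [0..<k] \<in> R"
    by (simp only:)
qed

text \<open>The chain consists of the operations \<open>t(x, \<dots>, x, y, z, \<dots>, z)\<close>, with \<open>y\<close> moving from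
  right to left, between two projections.\<close>

lemma absorbing_imp_jonsson_absorbing:
  assumes abs: "absorbing B \<A>" and \<Gamma>: "\<forall>(k, R) \<in> \<Gamma>. R \<subseteq> tuples (universe \<A>) k"
    and ops: "\<And>n. 1 \<le> n \<Longrightarrow> term_ops \<A> n = polymorphisms (universe \<A>) \<Gamma> n"
  shows "jonsson_absorbing B \<A>"
proof -
  let ?A = "universe \<A>"
  obtain n t where sub: "subuniverse B \<A>" and n: "1 \<le> n" and t: "t \<in> term_ops \<A> n"
    and idem: "\<And>x. x \<in> ?A \<Longrightarrow> t (replicate n x) = x"
    and absorb: "\<And>i xs. i < n \<Longrightarrow> xs \<in> tuples ?A n \<Longrightarrow> (\<And>j. j < n \<Longrightarrow> j \<noteq> i \<Longrightarrow> xs ! j \<in> B) \<Longrightarrow> t xs \<in> B"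
    using abs unfolding absorbing_def by blast
  have BA: "B \<subseteq> ?A" using sub by (simp add: subuniverse_def)
  define pr where "pr i = (\<lambda>xs \<in> tuples ?A 3. xs ! i)" for i
  have pr: "pr i \<in> polymorphisms ?A \<Gamma> 3" if "i < 3" for i
    unfolding pr_def by (rule polymorphism_projection[OF \<Gamma> that])
  have pr_app: "pr 0 [x, y, z] = x" "pr 1 [x, y, z] = y" "pr 2 [x, y, z] = z"
    if "x \<in> ?A" "y \<in> ?A" "z \<in> ?A" for x y z using that by (auto simp: pr_def)
  define gs where "gs j = replicate (n - 1 - j) (pr 0) @ [pr 1] @ replicate j (pr 2)" for j
  define e where "e j = (\<lambda>xs \<in> tuples ?A 3. t (map (\<lambda>g. g xs) (gs j)))" for j
  have e: "e j \<in> polymorphisms ?A \<Gamma> 3" if "j < n" for j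
    unfolding e_def
  proof (rule polymorphism_comp[OF \<Gamma>])
    show "t \<in> polymorphisms ?A \<Gamma> n" using t ops[OF n] by simp
    show "set (gs j) \<subseteq> polymorphisms ?A \<Gamma> 3" using pr by (auto simp: gs_def)
    show "length (gs j) = n" using that by (simp add: gs_def)
  qed
  have e_app: "e j [x, y, z] = t (replicate (n - 1 - j) x @ [y] @ replicate j z)"
    if "x \<in> ?A" "y \<in> ?A" "z \<in> ?A" for x y z j
    using that by (simp add: e_def gs_def pr_app pr_app[unfolded One_nat_def])
  \<comment> \<open>The operations \<open>e 0, ..., e (n - 1)\<close> are shifted by one to make
    room for the first projection.\<close>
  define c where "c i = (if i = 0 then pr 0 else if i \<le> n then e (i - 1) else pr 2)" for i
  have c: "c i \<in> term_ops \<A> 3" for i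
    using pr e ops[of 3] by (auto simp: c_def)
  then have "\<forall>i. \<exists>s. is_term \<A> 3 s \<and> c i = term_op \<A> 3 s" unfolding term_ops_def by blast
  then obtain d where d: "\<And>i. is_term \<A> 3 (d i)" "\<And>i. term_op \<A> 3 (d i) = c i" by metis
  have mid: "e j [b, a, b'] \<in> B" if "j < n" "b \<in> B" "a \<in> ?A" "b' \<in> B" for j a b b'
  proof -
    let ?xs = "replicate (n - 1 - j) b @ [a] @ replicate j b'"
    have "t ?xs \<in> B"
    proof (rule absorb)
      show "n - 1 - j < n" using n by simp
      show "?xs \<in> tuples ?A n" using that BA by auto
      show "?xs ! i \<in> B" if "i < n" "i \<noteq> n - 1 - j" for i
        using that \<open>j < n\<close> \<open>b \<in> B\<close> \<open>b' \<in> B\<close> by (auto simp: nth_append nth_Cons split: nat.split)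
    qed
    then show ?thesis using e_app that BA by (simp add: subset_iff)
  qed
  have "jonsson_chain B \<A> (Suc n) d"
    unfolding jonsson_chain_def d(2)
  proof (intro conjI allI ballI impI)
    show "is_term \<A> 3 (d i)" for i by (rule d(1))
    show "c i [b, a, b'] \<in> B" if "i \<le> Suc n" "b \<in> B" "a \<in> ?A" "b' \<in> B" for i b a b'
    proof -
      have "b \<in> ?A" "b' \<in> ?A" using that BA by auto
      then show ?thesis using that mid[of "i - 1" b a b'] by (auto simp: c_def pr_app)
    qed
    show "c i [x, y, y] = c (Suc i) [x, x, y]" if i: "i < Suc n" and xy: "x \<in> ?A" "y \<in> ?A" for i x y
    proof -
      have first: "e 0 [x, x, y] = x"
        using xy n idem[OF xy(1)] by (simp add: e_app replicate_append_same flip: replicate_Suc)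
      have last: "e (n - 1) [x, y, y] = y"
        using xy n idem[OF xy(2)] by (simp add: e_app flip: replicate_Suc)
      have step: "e j [x, y, y] = e (Suc j) [x, x, y]" if "Suc j < n" for j
      proof -
        have "n - 1 - j = Suc (n - 1 - Suc j)" using that by simp
        then show ?thesis using xy by (simp add: e_app replicate_app_Cons_same)
      qed
      show ?thesis
      proof (cases i)
        case 0
        then show ?thesis using first xy n by (simp add: c_def pr_app)
      next
        case (Suc j)
        then show ?thesis using last xy step[of j] i n by (auto simp: c_def pr_app not_less_eq_eq le_Suc_eq less_Suc_eq)
      qed
    qed
    show "c 0 [x, y, z] = x" "c (Suc n) [x, y, z] = z" if "x \<in> ?A" "y \<in> ?A" "z \<in> ?A" for x y z
      using that by (auto simp: c_def pr_app)
  qed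
  then show ?thesis using sub unfolding jonsson_absorbing_def by blast
qed

lemma jonsson_absorbing_imp_absorbing:
  assumes fin: "finite (universe \<A>)" and jon: "jonsson_absorbing B \<A>"
    and \<Gamma>: "\<forall>(k, R) \<in> \<Gamma>. R \<subseteq> tuples (universe \<A>) k" and fin_\<Gamma>: "finite \<Gamma>"
    and ops: "\<And>n. 1 \<le> n \<Longrightarrow> term_ops \<A> n = polymorphisms (universe \<A>) \<Gamma> n"
  shows "absorbing B \<A>"
proof -
  let ?A = "universe \<A>"
  obtain nc ds where sub: "subuniverse B \<A>" and jc: "jonsson_chain B \<A> nc ds"
    using jon unfolding jonsson_absorbing_def by blast
  have BA: "B \<subseteq> ?A" using sub by (simp add: subuniverse_def)
  define d where "d k x y z = term_op \<A> 3 (ds k) [x, y, z]" for k x y z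
  have d_poly: "term_op \<A> 3 (ds k) \<in> polymorphisms ?A \<Gamma> 3" if "k \<le> nc" for k
    using jc that ops[of 3] unfolding jonsson_chain_def term_ops_def by auto
  have d_A: "d k x y z \<in> ?A" if "k \<le> nc" "x \<in> ?A" "y \<in> ?A" "z \<in> ?A" for k x y z
    unfolding d_def using that by (intro polymorphism_values[OF d_poly]) auto
  have d_B: "d k x y z \<in> B" if "k \<le> nc" "x \<in> B" "y \<in> ?A" "z \<in> B" for k x y z
    using jc that unfolding jonsson_chain_def d_def by blast
  have chain: "jonsson_ops nc ?A d"
    using jc unfolding jonsson_chain_def jonsson_ops_def d_def by blast
  obtain N where N: "\<And>E E' P G. \<not> comb nc ?A d N E E' P G" using no_long_comb[OF fin] chain by blast
  obtain K where K: "\<And>k R. (k, R) \<in> \<Gamma> \<Longrightarrow> k \<le> K"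
    using finite_imageI[OF fin_\<Gamma>, of fst] by (metis Max_ge fst_conv image_eqI)
  define M where "M = max K 2"
  \<comment> \<open>\<open>N\<close> depends on the universe only, so it may determine the arity;
    more than \<open>M ^ N\<close> coordinates are needed in \<open>sat\<close>.\<close>
  define n where "n = M ^ N + 2"
  have n: "1 \<le> n" by (simp add: n_def)
  define V where "V = tuples ?A n"
  define S where "S = {f \<in> polymorphisms ?A \<Gamma> n. \<forall>x\<in>?A. f (replicate n x) = x}"
  \<comment> \<open>The singleton scopes ensure that each variable is covered and that the solution
    is idempotent at the constant tuples.\<close>
  define CC where "CC = ({column rs ` {..<k} |k R rs. (k, R) \<in> \<Gamma> \<and> rs \<in> tuples R n} \<union> (\<lambda>v. {v}) ` V) - {{}}"
  define near where "near v \<longleftrightarrow> (\<exists>i<n. \<forall>j<n. j \<noteq> i \<longrightarrow> v ! j \<in> B)" for v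
  define Lf where "Lf v = (if near v then B else ?A)" for v
  have finV: "finite V" unfolding V_def using finite_lists_length_eq[OF fin] .
  have S_A: "s v \<in> ?A" if "s \<in> S" "v \<in> V" for s v
    using that polymorphism_values unfolding S_def V_def by blast
  have rep: "replicate n x \<in> V" if "x \<in> ?A" for x using that by (auto simp: V_def)
  interpret leaf_instance nc ?A d V S CC Lf M
  proof
    show "finite ?A" "jonsson_ops nc ?A d" "finite V" "2 \<le> M" "{} \<notin> CC"
      using fin chain finV by (auto simp: M_def CC_def)
    have "column rs j \<in> V" if "(k, R) \<in> \<Gamma>" "rs \<in> tuples R n" "j < k" for k R rs j
    proof -
      have "R \<subseteq> tuples ?A k" using \<Gamma> that(1) by blast
      from column_tuples[OF this that(2,3)] show ?thesis unfolding V_def .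
    qed
    then have "\<Union> {column rs ` {..<k} |k R rs. (k, R) \<in> \<Gamma> \<and> rs \<in> tuples R n} \<subseteq> V" by blast
    moreover have "\<Union> ((\<lambda>v. {v}) ` V) = V" by simp
    moreover have "\<Union> (X - {{}}) = \<Union> X" for X :: "'a list set set" by auto
    ultimately show "\<Union> CC = V" unfolding CC_def by (simp only: Union_Un_distrib Un_absorb1)
    show "card C \<le> M" if C: "C \<in> CC" for C
    proof -
      have "card (column rs ` {..<k}) \<le> M" if "(k, R) \<in> \<Gamma>" for rs k R
        using K[OF that] card_image_le[of "{..<k}" "column rs"] by (simp add: M_def)
      then show ?thesis using C unfolding CC_def by (auto simp: M_def)
    qed
    show "s v \<in> ?A" if "s \<in> S" "v \<in> V" for s v using S_A that .
    show "\<exists>s\<in>S. \<forall>v\<in>V. s v = d k (r v) (p v) (q v)" if k: "k \<le> nc" and "r \<in> S" "p \<in> S" "q \<in> S" for k r p q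
    proof
      let ?s = "\<lambda>xs \<in> tuples ?A n. term_op \<A> 3 (ds k) (map (\<lambda>g. g xs) [r, p, q])"
      show "\<forall>v\<in>V. ?s v = d k (r v) (p v) (q v)" by (simp add: V_def d_def)
      have "?s \<in> polymorphisms ?A \<Gamma> n"
        using that by (intro polymorphism_comp[OF \<Gamma> d_poly[OF k]]) (auto simp: S_def)
      moreover have "?s (replicate n x) = x" if x: "x \<in> ?A" for x
        using rep[OF x] jonsson_ops_idem[OF chain x k] x \<open>r \<in> S\<close> \<open>p \<in> S\<close> \<open>q \<in> S\<close>
        by (simp add: S_def V_def d_def)
      ultimately show "?s \<in> S" by (simp add: S_def)
    qed
    show "d k x (p v) z \<in> Lf v" if "v \<in> V" "k \<le> nc" "x \<in> Lf v" "z \<in> Lf v" "p \<in> S" for k x z p v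
      using that d_A d_B S_A by (auto simp: Lf_def split: if_splits)
  qed
  have proj: "(\<lambda>xs \<in> tuples ?A n. xs ! i) \<in> S" if "i < n" for i
    using polymorphism_projection[OF \<Gamma> that] that rep unfolding S_def V_def by auto
  have sat: "\<exists>s\<in>S. \<forall>w\<in>W. s w \<in> Lf w" if W: "W \<subseteq> V" "card W \<le> M ^ N" for W
  proof -
    define idx where "idx w = (SOME i. i < n \<and> (\<forall>j<n. j \<noteq> i \<longrightarrow> w ! j \<in> B))" for w
    have "finite W" using W(1) finV finite_subset by blast
    then have "card (idx ` W) \<le> M ^ N" using W(2) card_image_le le_trans by blast
    \<comment> \<open>Some coordinate is not the exceptional index of any tuple in \<open>W\<close>;
      projecting to it gives a member of \<open>B\<close> at every near tuple in
      \<open>W\<close>.\<close>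
    then have "\<not> {..<n} \<subseteq> idx ` W" using card_mono[OF finite_imageI[OF \<open>finite W\<close>], of "{..<n}" idx] by (auto simp: n_def)
    then obtain i where i: "i < n" "i \<notin> idx ` W" by blast
    have "(\<lambda>xs \<in> tuples ?A n. xs ! i) w \<in> Lf w" if w: "w \<in> W" for w
    proof (cases "near w")
      case True
      then have "\<exists>i. i < n \<and> (\<forall>j<n. j \<noteq> i \<longrightarrow> w ! j \<in> B)" unfolding near_def by blast
      then have "\<forall>j<n. j \<noteq> idx w \<longrightarrow> w ! j \<in> B" unfolding idx_def by (rule someI_ex[THEN conjunct2])
      then show ?thesis using True i w W(1) unfolding Lf_def V_def by auto
    next
      case False
      then have "Lf w = ?A" by (simp add: Lf_def)
      then show ?thesis using S_A[OF proj[OF i(1)], of w] w W(1) by blast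
    qed
    then show ?thesis using proj[OF i(1)] by blast
  qed
  obtain f where f: "\<And>v. v \<in> V \<Longrightarrow> f v \<in> core v" and agree: "\<And>C. C \<in> CC \<Longrightarrow> \<exists>s\<in>S. \<forall>w\<in>C. s w = f w"
    using absorbing_instance_solution[OF core_absorbing_instance(1)[OF N sat]] by blast
  have f_Lf: "f v \<in> Lf v" if "v \<in> V" for v using f[OF that] core_absorbing_instance(2)[OF N sat that] by blast
  define t where "t = restrict f V"
  have "t \<in> polymorphisms ?A \<Gamma> n"
    unfolding polymorphisms_iff
  proof (intro conjI allI impI)
    show "t \<in> tuples ?A n \<rightarrow>\<^sub>E ?A"
      using f_Lf BA unfolding t_def V_def Lf_def by (fastforce split: if_splits)
    fix k R rs assume *: "(k, R) \<in> \<Gamma>" "rs \<in> tuples R n"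
    have "\<exists>s\<in>S. \<forall>j<k. s (column rs j) = f (column rs j)"
    proof (cases "k = 0")
      \<comment> \<open>A nullary relation yields the empty scope, which \<open>CC\<close> omits;
        any projection will do.\<close>
      case True
      then show ?thesis using proj[of 0] n by auto
    next
      case False
      then have "column rs ` {..<k} \<in> CC" using * unfolding CC_def by blast
      from agree[OF this] show ?thesis by auto
    qed
    then obtain s where s: "s \<in> S" "\<forall>j<k. s (column rs j) = f (column rs j)" by blast
    have R: "R \<subseteq> tuples ?A k" using \<Gamma> *(1) by blast
    have "column rs j \<in> V" if "j < k" for j
      using column_tuples[OF R *(2) that] unfolding V_def .
    then have "map (\<lambda>j. t (column rs j)) [0..<k] = map (\<lambda>j. s (column rs j)) [0..<k]"
      using s(2) by (simp add: t_def)
    also have "\<dots> \<in> R" using s(1) * unfolding S_def polymorphisms_iff by blast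
    finally show "map (\<lambda>j. t (column rs j)) [0..<k] \<in> R" .
  qed
  then have "t \<in> term_ops \<A> n" using ops[OF n] by simp
  moreover have "t (replicate n x) = x" if x: "x \<in> ?A" for x
  proof -
    have "{replicate n x} \<in> CC" using rep[OF x] unfolding CC_def by blast
    then show ?thesis using agree[of "{replicate n x}"] rep[OF x] x by (auto simp: t_def S_def)
  qed
  moreover have "t xs \<in> B" if "i < n" "xs \<in> tuples ?A n" "\<forall>j<n. j \<noteq> i \<longrightarrow> xs ! j \<in> B" for i xs
    using f_Lf[of xs] that unfolding t_def V_def Lf_def near_def by (auto split: if_splits)
  ultimately show ?thesis unfolding absorbing_def using sub n by blast
qed

theorem theorem1p1:
  fixes \<A> :: "('a, 'f) alg" and B :: "'a set"
  assumes "is_algebra \<A>"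
    and "finite (universe \<A>)"
    and "finitely_related \<A>"
    and "subuniverse B \<A>"
  shows "absorbing B \<A> \<longleftrightarrow> jonsson_absorbing B \<A>"
proof -
  obtain \<Gamma> where "finite \<Gamma>" "\<forall>(k, R) \<in> \<Gamma>. R \<subseteq> tuples (universe \<A>) k"
    "\<forall>n \<ge> 1. term_ops \<A> n = polymorphisms (universe \<A>) \<Gamma> n"
    using assms(3) unfolding finitely_related_def by blast
  then show ?thesis
    using absorbing_imp_jonsson_absorbing jonsson_absorbing_imp_absorbing[OF assms(2)] by blast
qed

end
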